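(* Let $T>0$, let $\alpha,\beta,f$ be real analytic functions on $\mathbb{R}$ and fix $u_0\in\mathbb{R}$. Denoting by $u$ the solution of $du=\alpha(u)\,dt+\beta(u)\,dW$ (in the Itô sense) with initial value $u_0$, the Martin–Siggia–Rose path integral expectation value $\mathbb{E}^{\mathrm{MSR}}[f(u_t)]$, $t\in[0,T]$, is represented by the formal series $$\mathbb{E}^{\mathrm{MSR}}[f(u_t)]=\sum_{\gamma\in\mathcal{M}_F}\frac{\Upsilon^{\alpha,\beta,f}_{u_0}(z^\gamma)}{\sigma_F(z^\gamma)}\,\Pi_t(z^\gamma).$$
   Context: MSR expectation (Itô prescription): $\Theta$ is the Heaviside function with $\Theta(0)=0$. The formal series $\mathbb{E}^{\mathrm{MSR}}[f(u_t)]=\sum_{N\ge0}M_N(t)$ is the perturbative expansion $$\Gamma^{mloc}_\Theta\Big[f(\psi(t))\otimes \exp_{\otimes}\Big(\int_0^T\big(\tilde\psi_s\alpha(\psi_s)+\tfrac12\tilde\psi_s^2\beta^2(\psi_s)\big)ds\Big)\Big]\Big|_{\psi=u_0,\ \tilde\psi=0},$$ where $\Gamma^{mloc}_\Theta$ contracts, in all possible ways, fields $\psi$ with auxiliary fields $\tilde\psi$ belonging to different factors, replacing a pair $(\psi_s,\tilde\psi_r)$ by $\Theta(s-r)$. Explicitly, $$M_N(t):=\frac1{N!}\int_{[0,T]^N}\Big[e^{D}\Big(f(x_0)\prod_{i=1}^N\big(y_i\alpha(x_i)+\tfrac12y_i^2\beta(x_i)^2\big)\Big)\Big]_{x_0=\dots=x_N=u_0,\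 y_1=\dots=y_N=0}ds_1\cdots ds_N,$$ with $s_0:=t$ and $D:=\sum_{0\le i\le N,\ 1\le j\le N,\ i\neq j}\Theta(s_i-s_j)\,\partial_{x_i}\partial_{y_j}$ (a finite sum when exponentiated, since the argument is polynomial in the $y_j$). The equality in the claim is between formal series graded by $N$: for each $N\ge 0$, $M_N(t)$ equals the sum over those $\gamma$ with $\sum_n\gamma_\alpha(n)+\sum_{\mathbf k}\gamma_\beta(\mathbf k)=N$ (only finitely many terms of which are non-zero). Feynman multi-indices: with $\mathbb N=\{0,1,2,\dots\}$ and $\mathbb N^2_\le=\{(k_1,k_2)\in\mathbb N^2:k_1\le k_2\}$, a Feynman multi-index $\gamma\in\mathcal{M}_F$ consists of finitely supported maps $\gamma_\alpha:\mathbb N\to\mathbb N$, $\gamma_\beta:\mathbb N^2_\le\to\mathbb N$, and $\gamma_\bullet:\mathbb N\to\{0,1\}$ with $\gamma_\bullet(n)=\mathbf 1_{n=m}$ for some fixed $m\in\mathbb N$. It is identified with the monomial $z^\gamma=\prod_{n,\mathbf k}z_{\alpha,n}^{\gamma_\alpha(n)}z_{\beta,\mathbf k}^{\gamma_\beta(\mathbf k)}z_{\bullet,n}^{\gamma_\bullet(n)}$. Elementary differential: $\Upsilon^{\alpha,\beta,f}_{u_0}(z^\gamma):=\prod_{n}(\alpha^{(n)}(u_0))^{\gamma_\alpha(n)}(f^{(n)}(u_0))^{\gamma_\bullet(n)}\prod_{(k_1,k_2)\in\mathbb N^2_\le}(\beta^{(k_1)}(u_0)\beta^{(k_2)}(u_0))^{\gamma_\beta(k_1,k_2)}$.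 Symmetry factor: $\sigma_F(z^\gamma):=\prod_n\gamma_\alpha(n)!\,(n!)^{\gamma_\alpha(n)+\gamma_\bullet(n)}\prod_{\mathbf k=(k_1,k_2)\in\mathbb N^2_\le}\gamma_\beta(\mathbf k)!\,(k_1!k_2!)^{\gamma_\beta(\mathbf k)}\;2^{\sum_i\gamma_\beta(i,i)}$. Realization map: $\Pi_t(z^\gamma)$ is obtained by contracting in all possible ways the root factor $\psi_t^{m}$ ($\gamma_\bullet(m)=1$) with $\gamma_\alpha(n)$ factors $\int_0^T\tilde\psi_s\psi_s^n\,ds$ for each $n$ and $\gamma_\beta(\mathbf k)$ factors $\int_0^T\tilde\psi_s^2\psi_s^{k_1+k_2}\,ds$ for each $\mathbf k$, and setting $\psi=\tilde\psi=0$. Explicitly, enumerate these non-root factors as $i=1,\dots,N$, with factor $i$ equal to $y_i^{a_i}x_i^{b_i}$, $(a_i,b_i)=(1,n)$ or $(2,k_1+k_2)$; then $$\Pi_t(z^\gamma):=\int_{[0,T]^N}\Big[e^{D}\Big(x_0^{m}\prod_{i=1}^Ny_i^{a_i}x_i^{b_i}\Big)\Big]_{x=0,\,y=0}ds_1\cdots ds_N,$$ with the same $D$ and $s_0=t$. In particular $\Pi_t(z_{\bullet,0})=1$. *)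

theory Defs
  imports "HOL-Analysis.Analysis"
begin

definition real_analytic :: "(real \<Rightarrow> real) \<Rightarrow> bool" where
  "real_analytic g \<longleftrightarrow>
     (\<forall>c. \<exists>r>0. \<exists>a :: nat \<Rightarrow> real. \<forall>x. \<bar>x - c\<bar> < r \<longrightarrow> (\<lambda>n. a n * (x - c) ^ n) sums g x)"

text \<open>The Ito prescription is the convention that the Heaviside function vanishes at \<open>0\<close>.\<close>

definition heaviside :: "real \<Rightarrow> real" where
  "heaviside r = (if r > 0 then 1 else 0)"

section \<open>The contraction operator\<close>

text \<open>Functions of the variables \<open>x\<^sub>0, x\<^sub>1, \<dots>\<close> (the fields) and \<open>y\<^sub>1, y\<^sub>2, \<dots>\<close> (the
  auxiliary fields) are represented as functions of two sequences; below, only \<open>x\<^sub>0, \<dots>, x\<^sub>N\<close>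
  and \<open>y\<^sub>1, \<dots>, y\<^sub>N\<close> occur.\<close>

type_synonym functional = "(nat \<Rightarrow> real) \<Rightarrow> (nat \<Rightarrow> real) \<Rightarrow> real"

definition partial_x :: "nat \<Rightarrow> functional \<Rightarrow> functional" where
  "partial_x i F = (\<lambda>x y. deriv (\<lambda>h. F (x(i := h)) y) (x i))"

definition partial_y :: "nat \<Rightarrow> functional \<Rightarrow> functional" where
  "partial_y j F = (\<lambda>x y. deriv (\<lambda>h. F x (y(j := h))) (y j))"

definition contraction :: "nat \<Rightarrow> (nat \<Rightarrow> real) \<Rightarrow> functional \<Rightarrow> functional" where
  "contraction N s F = (\<lambda>x y.
     \<Sum>(i, j) \<in> {(i, j). i \<le> N \<and> 1 \<le> j \<and> j \<le> N \<and> i \<noteq> j}.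
       heaviside (s i - s j) * partial_x i (partial_y j F) x y)"

text \<open>The series is a finite sum whenever \<open>F\<close> is smooth and polynomial in the variables \<open>y\<close>.\<close>

definition exp_contraction :: "nat \<Rightarrow> (nat \<Rightarrow> real) \<Rightarrow> functional \<Rightarrow> functional" where
  "exp_contraction N s F = (\<lambda>x y. \<Sum>k. (contraction N s ^^ k) F x y / fact k)"

text \<open>Integration over \<open>[0,T]\<^sup>N\<close> in the variables \<open>s\<^sub>1, \<dots>, s\<^sub>N\<close>; the root time is \<open>s\<^sub>0 = t\<close>.\<close>

definition time_integral :: "real \<Rightarrow> real \<Rightarrow> nat \<Rightarrow> ((nat \<Rightarrow> real) \<Rightarrow> real) \<Rightarrow> real" where
  "time_integral T t N G =
     (LINT s : ({1..N} \<rightarrow>\<^sub>E {0..T}) | PiM {1..N} (\<lambda>_. lborel). G (s(0 := t)))"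

section \<open>The Martin-Siggia-Rose expectation\<close>

text \<open>The formal series is represented by the sequence of its terms \<open>M\<^sub>N(t)\<close>.\<close>

definition msr_expectation ::
  "(real \<Rightarrow> real) \<Rightarrow> (real \<Rightarrow> real) \<Rightarrow> (real \<Rightarrow> real) \<Rightarrow> real \<Rightarrow> real \<Rightarrow> real \<Rightarrow> nat \<Rightarrow> real" where
  "msr_expectation \<alpha> \<beta> f u0 T t N =
     1 / fact N * time_integral T t N (\<lambda>s.
       exp_contraction N s
         (\<lambda>x y. f (x 0) * (\<Prod>i = 1..N. (y i * \<alpha> (x i) + 1 / 2 * (y i)\<^sup>2 * (\<beta> (x i))\<^sup>2)))
         (\<lambda>_. u0) (\<lambda>_. 0))"

section \<open>Feynman multi-indices\<close>

datatype multi_index = Multi_Index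
  (mi_alpha: "nat \<Rightarrow> nat") (mi_beta: "nat \<times> nat \<Rightarrow> nat") (mi_root: "nat \<Rightarrow> nat")

text \<open>A map on the pairs \<open>(k\<^sub>1, k\<^sub>2)\<close> with \<open>k\<^sub>1 \<le> k\<^sub>2\<close> is encoded by its extension by zero to all pairs.\<close>

definition feynman_multi_indices :: "multi_index set" where
  "feynman_multi_indices = {\<gamma>.
     finite {n. mi_alpha \<gamma> n \<noteq> 0} \<and>
     finite {k. mi_beta \<gamma> k \<noteq> 0} \<and>
     (\<forall>k1 k2. mi_beta \<gamma> (k1, k2) \<noteq> 0 \<longrightarrow> k1 \<le> k2) \<and>
     (\<exists>m. \<forall>n. mi_root \<gamma> n = (if n = m then 1 else 0))}"

definition mi_order :: "multi_index \<Rightarrow> nat" where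
  "mi_order \<gamma> = (\<Sum>n | mi_alpha \<gamma> n \<noteq> 0. mi_alpha \<gamma> n) + (\<Sum>k | mi_beta \<gamma> k \<noteq> 0. mi_beta \<gamma> k)"

text \<open>The products and sums over all \<open>n\<close> or all pairs are restricted to the supports, outside of
  which all factors are \<open>1\<close> and all summands are \<open>0\<close>.\<close>

definition elementary_differential ::
  "(real \<Rightarrow> real) \<Rightarrow> (real \<Rightarrow> real) \<Rightarrow> (real \<Rightarrow> real) \<Rightarrow> real \<Rightarrow> multi_index \<Rightarrow> real" where
  "elementary_differential \<alpha> \<beta> f u0 \<gamma> =
     (\<Prod>n | mi_alpha \<gamma> n \<noteq> 0 \<or> mi_root \<gamma> n \<noteq> 0.
        (deriv ^^ n) \<alpha> u0 ^ mi_alpha \<gamma> n * (deriv ^^ n) f u0 ^ mi_root \<gamma> n) *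
     (\<Prod>(k1, k2) \<in> {k. mi_beta \<gamma> k \<noteq> 0}.
        ((deriv ^^ k1) \<beta> u0 * (deriv ^^ k2) \<beta> u0) ^ mi_beta \<gamma> (k1, k2))"

definition symmetry_factor :: "multi_index \<Rightarrow> nat" where
  "symmetry_factor \<gamma> =
     (\<Prod>n | mi_alpha \<gamma> n \<noteq> 0 \<or> mi_root \<gamma> n \<noteq> 0.
        fact (mi_alpha \<gamma> n) * fact n ^ (mi_alpha \<gamma> n + mi_root \<gamma> n)) *
     (\<Prod>(k1, k2) \<in> {k. mi_beta \<gamma> k \<noteq> 0}.
        fact (mi_beta \<gamma> (k1, k2)) * (fact k1 * fact k2) ^ mi_beta \<gamma> (k1, k2)) *
     2 ^ (\<Sum>i | mi_beta \<gamma> (i, i) \<noteq> 0. mi_beta \<gamma> (i, i))"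

section \<open>The realization map\<close>

text \<open>The non-root factors: \<open>Alpha n\<close> stands for \<open>y x\<^sup>n\<close>, and \<open>Beta k1 k2\<close> for \<open>y\<^sup>2 x\<^sup>k\<close> with \<open>k = k1 + k2\<close>.\<close>

datatype factor = Alpha nat | Beta nat nat

fun y_exponent :: "factor \<Rightarrow> nat" where
  "y_exponent (Alpha n) = 1"
| "y_exponent (Beta k1 k2) = 2"

fun x_exponent :: "factor \<Rightarrow> nat" where
  "x_exponent (Alpha n) = n"
| "x_exponent (Beta k1 k2) = k1 + k2"

definition enumerates :: "factor list \<Rightarrow> multi_index \<Rightarrow> bool" where
  "enumerates fs \<gamma> \<longleftrightarrow>
     (\<forall>n. count_list fs (Alpha n) = mi_alpha \<gamma> n) \<and>
     (\<forall>k1 k2. count_list fs (Beta k1 k2) = mi_beta \<gamma> (k1, k2))"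

text \<open>The realization does not depend on the chosen enumeration, since permuting the factors
  amounts to permuting the integration variables. List positions start at \<open>0\<close>, so that factor
  number \<open>i\<close> is \<open>fs ! (i - 1)\<close>.\<close>

definition realization :: "real \<Rightarrow> real \<Rightarrow> multi_index \<Rightarrow> real" where
  "realization T t \<gamma> =
     (let m = (THE m. mi_root \<gamma> m = 1);
          fs = (SOME fs. enumerates fs \<gamma>);
          N = length fs
      in time_integral T t N (\<lambda>s.
           exp_contraction N s
             (\<lambda>x y. x 0 ^ m *
                (\<Prod>i = 1..N. y i ^ y_exponent (fs ! (i - 1)) * x i ^ x_exponent (fs ! (i - 1))))
             (\<lambda>_. 0) (\<lambda>_. 0)))"

end

theory Submission
  imports Defs "HOL-Combinatorics.Multiset_Permutations"
begin

text \<open>At \<open>y = 0\<close>, the operator \<open>e\<^sup>D\<close> applied to \<open>\<Prod>\<^sub>i g\<^sub>i(x\<^sub>i) \<Prod>\<^sub>j y\<^sub>j\<^bsup>a\<^sub>j\<^esup>\<close> sees each \<open>g\<^sub>i\<close> only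
  through finitely many of its derivatives at the base point. One may therefore replace every \<open>g\<^sub>i\<close>
  by a Taylor polynomial: the value is the sum over exponents \<open>d\<close> of
  \<open>\<Prod>\<^sub>i g\<^sub>i\<^bsup>(d\<^sub>i)\<^esup>(u\<^sub>0) / d\<^sub>i!\<close> times a universal \<^emph>\<open>contraction number\<close>, the value at \<open>0\<close> for the monomial
  \<open>\<Prod>\<^sub>i x\<^sub>i\<^bsup>d\<^sub>i\<^esup> \<Prod>\<^sub>j y\<^sub>j\<^bsup>a\<^sub>j\<^esup>\<close> (lemma \<open>exp_contraction_taylor\<close>). Each application of \<open>D\<close> uses up one
  auxiliary field and one field, so that only the power \<open>D\<^sup>k\<close> with \<open>k = \<Sum>\<^sub>j a\<^sub>j\<close> contributes, and it
  vanishes as soon as some \<open>d\<^sub>i\<close> exceeds \<open>k\<close>; this is what makes all sums finite.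

  In the Martin-Siggia-Rose functional, expand each vertex \<open>y \<alpha>(x) + y\<^sup>2 \<beta>(x)\<^sup>2 / 2\<close> in the same way. The
  coefficient of \<open>y x\<^sup>n\<close> is \<open>\<alpha>\<^bsup>(n)\<^esup> / n!\<close>. By the Leibniz rule that of \<open>y\<^sup>2 x\<^sup>n\<close> is half the sum of
  \<open>\<beta>\<^bsup>(k)\<^esup> \<beta>\<^bsup>(n - k)\<^esup> / (k! (n - k)!)\<close> over all \<open>k\<close>, that is, the sum over the unordered pairs
  \<open>k\<^sub>1 \<le> k\<^sub>2\<close> with \<open>k\<^sub>1 + k\<^sub>2 = n\<close> in which the diagonal pair alone keeps the factor \<open>1/2\<close>. Hence \<open>M\<^sub>N(t)\<close> is
  \<open>1/N!\<close> times a sum over the root exponent \<open>m\<close> and all lists of \<open>N\<close> factors \<open>Alpha n\<close> and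
  \<open>Beta k\<^sub>1 k\<^sub>2\<close> (lemma \<open>msr_expectation_eq_sum_lists\<close>).

  The integrated contraction number of a list is unchanged when the list is permuted, because a
  permutation of the times preserves Lebesgue measure (lemma \<open>factors_integral_cong_mset\<close>). It is thus
  the realization of the multi-index that counts the factors of the list. A multi-index is counted by
  \<open>N! / \<Prod> (multiplicities)!\<close> lists (lemma \<open>card_enumerations\<close>); the \<open>N!\<close> cancels, and the product of
  the weights divided by the factorials of the multiplicities is exactly the elementary differential
  divided by the symmetry factor (lemma \<open>elementary_differential_over_symmetry_factor\<close>).\<close>

section \<open>Smooth functions of one variable\<close>

definition smooth :: "(real \<Rightarrow> real) \<Rightarrow> bool" where
  "smooth g \<longleftrightarrow> (\<forall>n x. (deriv ^^ n) g field_differentiable at x)"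

lemma smooth_DERIV:
  assumes "smooth g"
  shows "((deriv ^^ n) g has_real_derivative (deriv ^^ Suc n) g x) (at x)"
  using assms unfolding smooth_def
  by (metis DERIV_deriv_iff_field_differentiable comp_apply funpow.simps(2))

text \<open>A convenient way to compute all derivatives at once: guess the sequence \<open>G\<close> of derivatives and
  check a single step.\<close>

lemma smoothI:
  assumes "G 0 = g" and "\<And>n x. (G n has_real_derivative G (Suc n) x) (at x)"
  shows "smooth g" and "(deriv ^^ n) g = G n"
proof -
  have *: "(deriv ^^ n) g = G n" for n
  proof (induction n)
    case (Suc n)
    then show ?case using assms(2) by (auto intro!: DERIV_imp_deriv)
  qed (simp add: assms)
  then show "(deriv ^^ n) g = G n" .
  show "smooth g"
    using assms(2) unfolding smooth_def * field_differentiable_def by blast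
qed

text \<open>A power series may be differentiated term by term inside its interval of convergence, and the
  differentiated series converges in the same interval. So analyticity is inherited by the derivative.\<close>

lemma real_analytic_DERIV:
  assumes "real_analytic g"
  shows "(g has_real_derivative deriv g x) (at x)" and "real_analytic (deriv g)"
proof -
  have main: "\<exists>r>0. \<exists>a :: nat \<Rightarrow> real. \<forall>x. \<bar>x - c\<bar> < r \<longrightarrow>
      (g has_real_derivative deriv g x) (at x) \<and> (\<lambda>n. a n * (x - c) ^ n) sums deriv g x" for c
  proof -
    obtain r a where r: "r > 0" and a: "\<And>x. \<bar>x - c\<bar> < r \<Longrightarrow> (\<lambda>n. a n * (x - c) ^ n) sums g x"
      using assms unfolding real_analytic_def by meson
    have sm: "summable (\<lambda>n. a n * z ^ n)" if "norm z < r" for z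
      using a[of "c + z"] that by (auto simp: sums_iff)
    have "(g has_real_derivative (\<Sum>n. diffs a n * (x - c) ^ n)) (at x)" if x: "\<bar>x - c\<bar> < r" for x
    proof (rule has_field_derivative_transform_within_open[where S = "ball c r"])
      have "((\<lambda>z. \<Sum>n. a n * z ^ n) has_real_derivative (\<Sum>n. diffs a n * (x - c) ^ n)) (at (x - c))"
        by (rule termdiffs_strong'[where K = r]) (use sm x in auto)
      then show "((\<lambda>z. \<Sum>n. a n * (z - c) ^ n) has_real_derivative
          (\<Sum>n. diffs a n * (x - c) ^ n)) (at x)"
        using DERIV_chain2[of "\<lambda>z. \<Sum>n. a n * z ^ n" _ "\<lambda>z. z - c" x 1 UNIV]
        by (simp add: DERIV_diff[where E = 0, simplified])
    qed (use x a in \<open>auto simp: dist_real_def abs_minus_commute sums_iff\<close>)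
    moreover have "summable (\<lambda>n. diffs a n * (x - c) ^ n)" if "\<bar>x - c\<bar> < r" for x
      by (rule termdiff_converges[where K = r]) (use sm that in auto)
    moreover from calculation(1) have "deriv g x = (\<Sum>n. diffs a n * (x - c) ^ n)" if "\<bar>x - c\<bar> < r" for x
      using that by (simp add: DERIV_imp_deriv)
    ultimately show ?thesis
      using r by (intro exI[of _ r] exI[of _ "diffs a"] conjI) (auto simp: sums_iff)
  qed
  show "(g has_real_derivative deriv g x) (at x)"
    using main[of x] by auto
  show "real_analytic (deriv g)"
    using main unfolding real_analytic_def by meson
qed

lemma real_analytic_imp_smooth:
  assumes "real_analytic g"
  shows "smooth g"
proof (rule smoothI)
  have "real_analytic ((deriv ^^ n) g)" for n
    by (induction n) (use assms real_analytic_DERIV(2) in auto)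
  then show "((deriv ^^ n) g has_real_derivative (deriv ^^ Suc n) g x) (at x)" for n x
    using real_analytic_DERIV(1) by simp
qed simp

text \<open>The Leibniz rule for higher derivatives; the induction step is Pascal's rule.\<close>

lemma
  assumes f: "smooth f" and g: "smooth g"
  shows smooth_mult: "smooth (\<lambda>x. f x * g x)"
    and higher_deriv_mult: "(deriv ^^ n) (\<lambda>x. f x * g x)
      = (\<lambda>x. \<Sum>k\<le>n. real (n choose k) * (deriv ^^ k) f x * (deriv ^^ (n - k)) g x)"
proof -
  define G where
    "G n x = (\<Sum>k\<le>n. real (n choose k) * (deriv ^^ k) f x * (deriv ^^ (n - k)) g x)" for n x
  have "(G n has_real_derivative G (Suc n) x) (at x)" for n x
  proof -
    define p where "p i j = (deriv ^^ i) f x * (deriv ^^ j) g x" for i j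
    have "(G n has_real_derivative
        (\<Sum>k\<le>n. real (n choose k) * (p (Suc k) (n - k) + p k (Suc (n - k))))) (at x)"
      unfolding G_def mult.assoc p_def
    proof (intro DERIV_sum DERIV_cmult)
      fix k
      show "((\<lambda>x. (deriv ^^ k) f x * (deriv ^^ (n - k)) g x) has_real_derivative
          (deriv ^^ Suc k) f x * (deriv ^^ (n - k)) g x
            + (deriv ^^ k) f x * (deriv ^^ Suc (n - k)) g x) (at x)"
        using DERIV_mult[OF smooth_DERIV[OF f, of k x] smooth_DERIV[OF g, of "n - k" x]]
        by (simp add: algebra_simps)
    qed
    \<comment> \<open>The second sum may run up to \<open>Suc n\<close> because \<open>n choose Suc n = 0\<close>.\<close>
    also have "(\<Sum>k\<le>n. real (n choose k) * (p (Suc k) (n - k) + p k (Suc (n - k))))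
        = (\<Sum>k\<le>n. real (n choose k) * p (Suc k) (n - k))
          + (\<Sum>k\<le>Suc n. real (n choose k) * p k (Suc n - k))"
      by (simp add: sum.distrib distrib_left Suc_diff_le)
    also have "\<dots> = (\<Sum>k\<le>Suc n. real (Suc n choose k) * p k (Suc n - k))"
      unfolding sum.atMost_Suc_shift by (simp add: sum.distrib distrib_right)
    finally show ?thesis by (simp only: G_def[abs_def] p_def mult.assoc)
  qed
  then have "smooth (\<lambda>x. f x * g x)" "(deriv ^^ n) (\<lambda>x. f x * g x) = G n"
    using smoothI[of G "\<lambda>x. f x * g x"] by (auto simp: G_def fun_eq_iff)
  then show "smooth (\<lambda>x. f x * g x)" "(deriv ^^ n) (\<lambda>x. f x * g x)
      = (\<lambda>x. \<Sum>k\<le>n. real (n choose k) * (deriv ^^ k) f x * (deriv ^^ (n - k)) g x)"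
    by (auto simp: G_def fun_eq_iff)
qed

lemma
  shows smooth_power: "smooth (\<lambda>x. x ^ d)"
    and higher_deriv_power_0: "(deriv ^^ c) (\<lambda>x::real. x ^ d) 0 = (if c = d then fact d else 0)"
proof -
  \<comment> \<open>For \<open>c > d\<close> the falling factorial vanishes by its factor \<open>l = d\<close>, so that the truncated exponent
    \<open>d - c\<close> does no harm.\<close>
  define G where "G c x = real (\<Prod>l<c. d - l) * x ^ (d - c)" for c and x :: real
  have "(G c has_real_derivative G (Suc c) x) (at x)" for c x
    unfolding G_def by (auto intro!: derivative_eq_intros)
  then have "smooth (\<lambda>x. x ^ d)" "(deriv ^^ c) (\<lambda>x. x ^ d) = G c"
    using smoothI[of G "\<lambda>x. x ^ d"] by (auto simp: G_def fun_eq_iff)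
  moreover have "G c 0 = (if c = d then fact d else 0)"
  proof (cases c d rule: linorder_cases)
    case equal
    have "(\<Prod>l<d. d - l) = fact d"
      unfolding fact_prod_rev by (simp only: lessThan_atLeast0 of_nat_id)
    then have "real (\<Prod>l<d. d - l) = fact d"
      by (metis of_nat_fact)
    with equal show ?thesis by (simp add: G_def del: of_nat_prod)
  qed (auto simp: G_def)
  ultimately show "smooth (\<lambda>x. x ^ d)"
    "(deriv ^^ c) (\<lambda>x::real. x ^ d) 0 = (if c = d then fact d else 0)"
    by simp_all
qed

section \<open>Powers of the contraction operator on products\<close>

abbreviation contraction_pairs :: "nat \<Rightarrow> (nat \<times> nat) set" where
  "contraction_pairs N \<equiv> {(i, j). i \<le> N \<and> 1 \<le> j \<and> j \<le> N \<and> i \<noteq> j}"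

lemma finite_contraction_pairs [simp]: "finite (contraction_pairs N)"
  by (rule finite_subset[of _ "{..N} \<times> {..N}"]) auto

text \<open>The \<open>k\<close>-th power of the contraction operator applied to the product of the functions
  \<open>g\<^sub>i\<^bsup>(c\<^sub>i)\<^esup>(x\<^sub>i)\<close> and the powers \<open>y\<^sub>j\<^bsup>a\<^sub>j\<^esup>\<close>. The formula applies the first contraction \<open>(i, j)\<close> to the
  arguments \<open>c\<close> and \<open>a\<close> rather than differentiating a function, which turns statements about iterated
  derivatives into inductions over \<open>k\<close>. That it is indeed this power is
  \<open>contraction_funpow_sum\<close> below.\<close>

primrec contracted_product ::
  "nat \<Rightarrow> (nat \<Rightarrow> real) \<Rightarrow> (nat \<Rightarrow> real \<Rightarrow> real) \<Rightarrow> nat \<Rightarrow> (nat \<Rightarrow> nat) \<Rightarrow> (nat \<Rightarrow> nat) \<Rightarrow> functional"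
where
  "contracted_product N s g 0 c a =
     (\<lambda>x y. (\<Prod>i\<le>N. (deriv ^^ c i) (g i) (x i)) * (\<Prod>j = 1..N. y j ^ a j))"
| "contracted_product N s g (Suc k) c a =
     (\<lambda>x y. \<Sum>(i, j) \<in> contraction_pairs N. heaviside (s i - s j) * real (a j) *
        contracted_product N s g k (c(i := Suc (c i))) (a(j := a j - 1)) x y)"

text \<open>A derivative commutes with the earlier contractions, so it also acts on the arguments \<open>c\<close> and \<open>a\<close>
  alone. For \<open>a\<^sub>j = 0\<close> the truncated exponent \<open>a\<^sub>j - 1\<close> is harmless, since its coefficient is \<open>0\<close>.\<close>

lemma contracted_product_DERIV_y:
  assumes j: "j \<in> {1..N}"
  shows "((\<lambda>h. contracted_product N s g k c a x (y(j := h))) has_real_derivative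
    real (a j) * contracted_product N s g k c (a(j := a j - 1)) x (y(j := z))) (at z)"
proof (induction k arbitrary: c a)
  case 0
  define R where "R = (\<Prod>i\<le>N. (deriv ^^ c i) (g i) (x i)) * (\<Prod>l \<in> {1..N} - {j}. y l ^ a l)"
  have split: "(\<Prod>l = 1..N. (y(j := h)) l ^ b l) = h ^ b j * (\<Prod>l \<in> {1..N} - {j}. y l ^ b l)" for h b
    by (subst prod.remove[OF _ j]) (auto intro!: prod.cong)
  have "contracted_product N s g 0 c a x (y(j := h)) = R * h ^ a j" for h
    unfolding contracted_product.simps split by (simp add: R_def)
  moreover have "contracted_product N s g 0 c (a(j := a j - 1)) x (y(j := z)) = R * z ^ (a j - 1)"
    unfolding contracted_product.simps split by (simp add: R_def)
  ultimately show ?case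
    by (auto intro!: derivative_eq_intros)
next
  case (Suc k)
  have "((\<lambda>h. contracted_product N s g (Suc k) c a x (y(j := h))) has_real_derivative
      (\<Sum>(i, l) \<in> contraction_pairs N. heaviside (s i - s l) * real (a l) *
        (real ((a(l := a l - 1)) j) * contracted_product N s g k (c(i := Suc (c i)))
           ((a(l := a l - 1))(j := (a(l := a l - 1)) j - 1)) x (y(j := z))))) (at z)"
    unfolding contracted_product.simps case_prod_unfold
    by (intro DERIV_sum DERIV_cmult Suc.IH)
  also have "(\<Sum>(i, l) \<in> contraction_pairs N. heaviside (s i - s l) * real (a l) *
        (real ((a(l := a l - 1)) j) * contracted_product N s g k (c(i := Suc (c i)))
           ((a(l := a l - 1))(j := (a(l := a l - 1)) j - 1)) x (y(j := z))))
     = real (a j) * contracted_product N s g (Suc k) c (a(j := a j - 1)) x (y(j := z))"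
    unfolding contracted_product.simps sum_distrib_left
  proof (intro sum.cong refl, clarify)
    fix i l
    \<comment> \<open>For \<open>l = j\<close> both sides carry the coefficient \<open>a\<^sub>j (a\<^sub>j - 1)\<close>; otherwise the updates commute.\<close>
    show "heaviside (s i - s l) * real (a l) *
        (real ((a(l := a l - 1)) j) * contracted_product N s g k (c(i := Suc (c i)))
           ((a(l := a l - 1))(j := (a(l := a l - 1)) j - 1)) x (y(j := z)))
      = real (a j) * (heaviside (s i - s l) * real ((a(j := a j - 1)) l) *
          contracted_product N s g k (c(i := Suc (c i)))
            ((a(j := a j - 1))(l := (a(j := a j - 1)) l - 1)) x (y(j := z)))"
      by (cases "l = j") (simp_all add: fun_upd_twist)
  qed
  finally show ?case .
qed

lemma contracted_product_DERIV_x: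
  assumes i: "i \<le> N" and g: "smooth (g i)"
  shows "((\<lambda>h. contracted_product N s g k c a (x(i := h)) y) has_real_derivative
    contracted_product N s g k (c(i := Suc (c i))) a (x(i := z)) y) (at z)"
proof (induction k arbitrary: c a)
  case 0
  define R where "R = (\<Prod>l \<in> {..N} - {i}. (deriv ^^ c l) (g l) (x l)) * (\<Prod>j = 1..N. y j ^ a j)"
  have split: "(\<Prod>l\<le>N. (deriv ^^ b l) (g l) ((x(i := h)) l))
      = (deriv ^^ b i) (g i) h * (\<Prod>l \<in> {..N} - {i}. (deriv ^^ b l) (g l) (x l))" for h b
    using i by (subst prod.remove[of _ i]) (auto intro!: prod.cong)
  have "contracted_product N s g 0 c a (x(i := h)) y = (deriv ^^ c i) (g i) h * R" for h
    unfolding contracted_product.simps split by (simp add: R_def)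
  moreover have "contracted_product N s g 0 (c(i := Suc (c i))) a (x(i := z)) y
      = (deriv ^^ Suc (c i)) (g i) z * R"
    unfolding contracted_product.simps split by (simp add: R_def)
  moreover have "((\<lambda>h. (deriv ^^ c i) (g i) h * R) has_real_derivative
      (deriv ^^ Suc (c i)) (g i) z * R) (at z)"
    by (intro DERIV_cmult_right smooth_DERIV g)
  ultimately show ?case
    by simp
next
  case (Suc k)
  have comm: "(c(i := Suc (c i)))(l := Suc ((c(i := Suc (c i))) l))
      = (c(l := Suc (c l)))(i := Suc ((c(l := Suc (c l))) i))" for l
    by (auto simp: fun_eq_iff)
  show ?case
    unfolding contracted_product.simps case_prod_unfold comm
    by (intro DERIV_sum DERIV_cmult Suc.IH)
qed

text \<open>The operators \<open>partial_x\<close> and \<open>partial_y\<close> are additive only on differentiable functionals.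
  Treating a whole linear combination of products at once keeps every intermediate functional in a
  form whose derivatives are known.\<close>

lemma contraction_funpow_sum:
  assumes "\<And>q i. q \<in> Q \<Longrightarrow> i \<le> N \<Longrightarrow> smooth (g q i)"
  shows "(contraction N s ^^ k) (\<lambda>x y. \<Sum>q\<in>Q. w q * contracted_product N s (g q) 0 (c q) (a q) x y)
    = (\<lambda>x y. \<Sum>q\<in>Q. w q * contracted_product N s (g q) k (c q) (a q) x y)"
proof (induction k)
  case (Suc k)
  let ?P = "\<lambda>q k c a. contracted_product N s (g q) k c a"
  have y: "partial_y j (\<lambda>x y. \<Sum>q\<in>Q. w q * ?P q k (c q) (a q) x y)
      = (\<lambda>x y. \<Sum>q\<in>Q. w q * (real (a q j) * ?P q k (c q) ((a q)(j := a q j - 1)) x y))"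
    if "j \<in> {1..N}" for j
  proof (intro ext)
    fix x y
    have "((\<lambda>h. \<Sum>q\<in>Q. w q * ?P q k (c q) (a q) x (y(j := h))) has_real_derivative
        (\<Sum>q\<in>Q. w q * (real (a q j) * ?P q k (c q) ((a q)(j := a q j - 1)) x (y(j := y j))))) (at (y j))"
      by (intro DERIV_sum DERIV_cmult contracted_product_DERIV_y that)
    then show "partial_y j (\<lambda>x y. \<Sum>q\<in>Q. w q * ?P q k (c q) (a q) x y) x y
        = (\<Sum>q\<in>Q. w q * (real (a q j) * ?P q k (c q) ((a q)(j := a q j - 1)) x y))"
      unfolding partial_y_def by (simp add: DERIV_imp_deriv)
  qed
  have x: "partial_x i (\<lambda>x y. \<Sum>q\<in>Q. w q * (real (a q j) * ?P q k (c q) ((a q)(j := a q j - 1)) x y)) x y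
      = (\<Sum>q\<in>Q. w q * (real (a q j) * ?P q k ((c q)(i := Suc (c q i))) ((a q)(j := a q j - 1)) x y))"
    if "i \<le> N" for i j x y
  proof -
    have "((\<lambda>h. \<Sum>q\<in>Q. w q * (real (a q j) * ?P q k (c q) ((a q)(j := a q j - 1)) (x(i := h)) y))
        has_real_derivative (\<Sum>q\<in>Q. w q * (real (a q j) *
          ?P q k ((c q)(i := Suc (c q i))) ((a q)(j := a q j - 1)) (x(i := x i)) y))) (at (x i))"
      by (intro DERIV_sum DERIV_cmult contracted_product_DERIV_x that assms)
    then show ?thesis
      unfolding partial_x_def by (simp add: DERIV_imp_deriv)
  qed
  have "contraction N s (\<lambda>x y. \<Sum>q\<in>Q. w q * ?P q k (c q) (a q) x y) x y
      = (\<Sum>q\<in>Q. w q * ?P q (Suc k) (c q) (a q) x y)" for x y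
  proof -
    have "contraction N s (\<lambda>x y. \<Sum>q\<in>Q. w q * ?P q k (c q) (a q) x y) x y
        = (\<Sum>(i, j) \<in> contraction_pairs N. heaviside (s i - s j) * (\<Sum>q\<in>Q. w q * (real (a q j) *
            ?P q k ((c q)(i := Suc (c q i))) ((a q)(j := a q j - 1)) x y)))"
      unfolding contraction_def by (intro sum.cong refl) (clarsimp simp: y x simp del: One_nat_def)
    also have "\<dots> = (\<Sum>q\<in>Q. w q * ?P q (Suc k) (c q) (a q) x y)"
      unfolding sum_distrib_left contracted_product.simps case_prod_unfold
      by (subst sum.swap) (simp add: mult_ac)
    finally show ?thesis .
  qed
  then show ?case
    by (simp only: funpow.simps comp_apply Suc.IH)
qed simp

text \<open>Every contraction removes one auxiliary field. At \<open>y = 0\<close> what survives must have used up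
  all \<open>\<Sum>\<^sub>j a\<^sub>j\<close> of them, neither fewer nor more.\<close>

lemma contracted_product_at_0_eq_0:
  assumes "k \<noteq> (\<Sum>j = 1..N. a j)"
  shows "contracted_product N s g k c a x (\<lambda>_. 0) = 0"
  using assms
proof (induction k arbitrary: c a)
  case 0
  then show ?case by auto
next
  case (Suc k)
  have "heaviside (s i - s j) * real (a j) *
        contracted_product N s g k (c(i := Suc (c i))) (a(j := a j - 1)) x (\<lambda>_. 0) = 0"
    if "(i, j) \<in> contraction_pairs N" for i j
  proof (cases "a j = 0")
    case False
    have "(\<Sum>l = 1..N. b l) = b j + (\<Sum>l \<in> {1..N} - {j}. b l)" for b :: "nat \<Rightarrow> nat"
      by (rule sum.remove) (use that in auto)
    moreover have "(\<Sum>l \<in> {1..N} - {j}. (a(j := a j - 1)) l) = (\<Sum>l \<in> {1..N} - {j}. a l)"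
      by (intro sum.cong) auto
    ultimately have "(\<Sum>l = 1..N. a l) = Suc (\<Sum>l = 1..N. (a(j := a j - 1)) l)"
      using False by simp
    with Suc.prems have "k \<noteq> (\<Sum>l = 1..N. (a(j := a j - 1)) l)"
      by metis
    then show ?thesis by (simp add: Suc.IH)
  qed simp
  then show ?case
    by (auto intro!: sum.neutral)
qed

text \<open>The reduction to monomials. Without contractions it is the identity
  \<open>g\<^bsup>(c)\<^esup>(u) = \<Sum>\<^sub>n g\<^bsup>(n)\<^esup>(u) / n! \<cdot> (x\<^sup>n)\<^bsup>(c)\<^esup>(0)\<close>, in which only \<open>n = c\<close> contributes, multiplied out over the
  sites. The bound \<open>B\<close> leaves room for the \<open>k\<close> derivatives still to come.\<close>

lemma contracted_product_taylor:
  assumes "\<And>i. i \<le> N \<Longrightarrow> c i + k \<le> B"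
  shows "contracted_product N s g k c a (\<lambda>_. u) (\<lambda>_. 0) =
    (\<Sum>d \<in> {..N} \<rightarrow>\<^sub>E {..B}. (\<Prod>i\<le>N. (deriv ^^ d i) (g i) u / fact (d i)) *
       contracted_product N s (\<lambda>i x. x ^ d i) k c a (\<lambda>_. 0) (\<lambda>_. 0))"
  using assms
proof (induction k arbitrary: c a)
  case 0
  have "(\<Sum>n\<le>B. (deriv ^^ n) (g i) u / fact n * (deriv ^^ c i) (\<lambda>x. x ^ n) 0) = (deriv ^^ c i) (g i) u"
    if "i \<le> N" for i
  proof -
    have "(\<Sum>n\<le>B. (deriv ^^ n) (g i) u / fact n * (deriv ^^ c i) (\<lambda>x. x ^ n) 0)
        = (\<Sum>n\<le>B. if n = c i then (deriv ^^ n) (g i) u else 0)"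
      by (intro sum.cong) (auto simp: higher_deriv_power_0)
    also have "\<dots> = (deriv ^^ c i) (g i) u"
      using 0[OF that] by simp
    finally show ?thesis .
  qed
  then have "(\<Prod>i\<le>N. (deriv ^^ c i) (g i) u)
      = (\<Prod>i\<le>N. \<Sum>n\<le>B. (deriv ^^ n) (g i) u / fact n * (deriv ^^ c i) (\<lambda>x. x ^ n) 0)"
    by simp
  also have "\<dots> = (\<Sum>d \<in> {..N} \<rightarrow>\<^sub>E {..B}.
      \<Prod>i\<le>N. (deriv ^^ d i) (g i) u / fact (d i) * (deriv ^^ c i) (\<lambda>x. x ^ d i) 0)"
    by (rule prod_sum_PiE) auto
  finally show ?case
    unfolding contracted_product.simps by (simp only: sum_distrib_right prod.distrib mult.assoc)
next
  case (Suc k)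
  let ?w = "\<lambda>d. \<Prod>i\<le>N. (deriv ^^ d i) (g i) u / fact (d i)"
  have "contracted_product N s g k (c(i := Suc (c i))) (a(j := a j - 1)) (\<lambda>_. u) (\<lambda>_. 0) =
    (\<Sum>d \<in> {..N} \<rightarrow>\<^sub>E {..B}. ?w d *
       contracted_product N s (\<lambda>i x. x ^ d i) k (c(i := Suc (c i))) (a(j := a j - 1)) (\<lambda>_. 0) (\<lambda>_. 0))"
    for i j
    by (rule Suc.IH) (use Suc.prems in fastforce)
  then show ?case
    unfolding contracted_product.simps sum_distrib_left case_prod_unfold
    by (subst sum.swap) (simp add: sum_distrib_left mult_ac)
qed

section \<open>Contraction numbers\<close>

definition contraction_number :: "nat \<Rightarrow> (nat \<Rightarrow> real) \<Rightarrow> (nat \<Rightarrow> nat) \<Rightarrow> (nat \<Rightarrow> nat) \<Rightarrow> real" where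
  "contraction_number N s d a =
     exp_contraction N s (\<lambda>x y. (\<Prod>i\<le>N. x i ^ d i) * (\<Prod>j = 1..N. y j ^ a j)) (\<lambda>_. 0) (\<lambda>_. 0)"

text \<open>Evaluated at \<open>y = 0\<close>, the exponential series of each product reduces to a single term.\<close>

lemma exp_contraction_sum:
  assumes "\<And>q i. q \<in> Q \<Longrightarrow> i \<le> N \<Longrightarrow> smooth (g q i)"
  shows "exp_contraction N s
      (\<lambda>x y. \<Sum>q\<in>Q. w q * ((\<Prod>i\<le>N. g q i (x i)) * (\<Prod>j = 1..N. y j ^ a q j))) (\<lambda>_. u) (\<lambda>_. 0)
    = (\<Sum>q\<in>Q. w q * (contracted_product N s (g q) (\<Sum>j = 1..N. a q j) (\<lambda>_. 0) (a q) (\<lambda>_. u) (\<lambda>_. 0)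
         / fact (\<Sum>j = 1..N. a q j)))"
proof -
  let ?P = "\<lambda>q k. contracted_product N s (g q) k (\<lambda>_. 0) (a q) (\<lambda>_. u) (\<lambda>_. 0)"
  let ?F = "\<lambda>x y. \<Sum>q\<in>Q. w q * ((\<Prod>i\<le>N. g q i (x i)) * (\<Prod>j = 1..N. y j ^ a q j))"
  have "(\<lambda>k. w q * (?P q k / fact k)) sums (w q * (?P q (\<Sum>j = 1..N. a q j) / fact (\<Sum>j = 1..N. a q j)))" for q
  proof (rule sums_mult)
    have "(\<lambda>k. ?P q k / fact k) = (\<lambda>k. if k = (\<Sum>j = 1..N. a q j) then ?P q k / fact k else 0)"
      by (simp add: fun_eq_iff contracted_product_at_0_eq_0)
    then show "(\<lambda>k. ?P q k / fact k) sums (?P q (\<Sum>j = 1..N. a q j) / fact (\<Sum>j = 1..N. a q j))"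
      using sums_single[of "\<Sum>j = 1..N. a q j" "\<lambda>k. ?P q k / fact k"] by simp
  qed
  then have "(\<lambda>k. \<Sum>q\<in>Q. w q * (?P q k / fact k)) sums
      (\<Sum>q\<in>Q. w q * (?P q (\<Sum>j = 1..N. a q j) / fact (\<Sum>j = 1..N. a q j)))"
    by (intro sums_sum)
  moreover have "(contraction N s ^^ k) ?F (\<lambda>_. u) (\<lambda>_. 0) / fact k = (\<Sum>q\<in>Q. w q * (?P q k / fact k))" for k
  proof -
    have "(contraction N s ^^ k) (\<lambda>x y. \<Sum>q\<in>Q. w q * contracted_product N s (g q) 0 (\<lambda>_. 0) (a q) x y)
        = (\<lambda>x y. \<Sum>q\<in>Q. w q * contracted_product N s (g q) k (\<lambda>_. 0) (a q) x y)"
      by (rule contraction_funpow_sum) (use assms in blast)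
    then show ?thesis
      by (simp add: sum_divide_distrib)
  qed
  ultimately show ?thesis
    unfolding exp_contraction_def by (simp add: sums_iff)
qed

lemma contraction_number_eq:
  "contraction_number N s d a =
     contracted_product N s (\<lambda>i x. x ^ d i) (\<Sum>j = 1..N. a j) (\<lambda>_. 0) a (\<lambda>_. 0) (\<lambda>_. 0)
       / fact (\<Sum>j = 1..N. a j)"
  using exp_contraction_sum[of "{()}" N "\<lambda>_ i x. x ^ d i" s "\<lambda>_. 1" "\<lambda>_. a" 0]
  by (simp add: contraction_number_def smooth_power)

lemma exp_contraction_taylor:
  assumes "\<And>q i. q \<in> Q \<Longrightarrow> i \<le> N \<Longrightarrow> smooth (g q i)"
    and "\<And>q. q \<in> Q \<Longrightarrow> (\<Sum>j = 1..N. a q j) \<le> B"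
  shows "exp_contraction N s
      (\<lambda>x y. \<Sum>q\<in>Q. w q * ((\<Prod>i\<le>N. g q i (x i)) * (\<Prod>j = 1..N. y j ^ a q j))) (\<lambda>_. u) (\<lambda>_. 0)
    = (\<Sum>q\<in>Q. \<Sum>d \<in> {..N} \<rightarrow>\<^sub>E {..B}.
         w q * (\<Prod>i\<le>N. (deriv ^^ d i) (g q i) u / fact (d i)) * contraction_number N s d (a q))"
proof -
  have "contracted_product N s (g q) (\<Sum>j = 1..N. a q j) (\<lambda>_. 0) (a q) (\<lambda>_. u) (\<lambda>_. 0)
      / fact (\<Sum>j = 1..N. a q j)
    = (\<Sum>d \<in> {..N} \<rightarrow>\<^sub>E {..B}.
        (\<Prod>i\<le>N. (deriv ^^ d i) (g q i) u / fact (d i)) * contraction_number N s d (a q))"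
    if "q \<in> Q" for q
    using contracted_product_taylor[of N "\<lambda>_. 0" "\<Sum>j = 1..N. a q j" B s "g q" "a q" u] assms(2)[OF that]
    by (simp add: contraction_number_eq sum_divide_distrib)
  then show ?thesis
    by (subst exp_contraction_sum) (use assms(1) in \<open>simp_all add: sum_distrib_left mult.assoc\<close>)
qed

text \<open>With fewer than \<open>d\<^sub>i\<close> derivatives, a factor \<open>x\<^sub>i\<close> is left over and vanishes at \<open>0\<close>.\<close>

lemma contracted_power_eq_0:
  assumes "i \<le> N" and "c i + k < d i"
  shows "contracted_product N s (\<lambda>i x. x ^ d i) k c a (\<lambda>_. 0) y = 0"
  using assms(2)
proof (induction k arbitrary: c a)
  case 0
  then show ?case using assms(1) by (auto simp: higher_deriv_power_0)
next
  case (Suc k)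
  then have "contracted_product N s (\<lambda>i x. x ^ d i) k (c(l := Suc (c l))) b (\<lambda>_. 0) y = 0" for l b
    by (intro Suc.IH) auto
  then show ?case
    by simp
qed

lemma contraction_number_eq_0:
  assumes "i \<le> N" and "(\<Sum>j = 1..N. a j) < d i"
  shows "contraction_number N s d a = 0"
  using contracted_power_eq_0[of i N "\<lambda>_. 0" "\<Sum>j = 1..N. a j" d] assms
  by (simp add: contraction_number_eq)

lemma contracted_product_cong_times:
  assumes "\<And>i. i \<le> N \<Longrightarrow> s i = s' i"
  shows "contracted_product N s g k c a x y = contracted_product N s' g k c a x y"
proof (induction k arbitrary: c a)
  case (Suc k)
  show ?case
    unfolding contracted_product.simps using assms
    by (intro sum.cong refl) (clarsimp simp: Suc.IH simp del: fun_upd_apply)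
qed simp

lemma contraction_number_cong:
  assumes "\<And>i. i \<le> N \<Longrightarrow> s i = s' i" and "\<And>i. i \<le> N \<Longrightarrow> d i = d' i"
    and "\<And>j. j \<in> {1..N} \<Longrightarrow> a j = a' j"
  shows "contraction_number N s d a = contraction_number N s' d' a'"
proof -
  have "contraction_number N s d a = contraction_number N s' d a"
    unfolding contraction_number_eq using contracted_product_cong_times[OF assms(1)] by simp
  also have "(\<lambda>x y :: nat \<Rightarrow> real. (\<Prod>i\<le>N. x i ^ d i) * (\<Prod>j = 1..N. y j ^ a j)) =
      (\<lambda>x y :: nat \<Rightarrow> real. (\<Prod>i\<le>N. x i ^ d' i) * (\<Prod>j = 1..N. y j ^ a' j))"
    using assms(2,3) by (intro ext arg_cong2[where f = "(*)"] prod.cong) auto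
  then have "contraction_number N s' d a = contraction_number N s' d' a'"
    by (simp add: contraction_number_def)
  finally show ?thesis .
qed

text \<open>Relabelling the vertices together with their times, functions and exponents leaves the set of
  contractions invariant. The root \<open>0\<close> is kept fixed.\<close>

lemma contracted_product_permute:
  assumes p: "p permutes {1..N}"
  shows "contracted_product N (s \<circ> p) (g \<circ> p) k (c \<circ> p) (a \<circ> p) (x \<circ> p) (y \<circ> p)
    = contracted_product N s g k c a x y"
proof (induction k arbitrary: c a)
  case 0
  have p': "p permutes {..N}"
    by (rule permutes_subset[OF p]) auto
  show ?case
    using prod.permute[OF p', of "\<lambda>i. (deriv ^^ c i) (g i) (x i)"]
      prod.permute[OF p, of "\<lambda>j. y j ^ a j"]
    by (simp add: o_def)
next
  case (Suc k)
  have inj: "p i = p j \<longleftrightarrow> i = j" for i j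
    using permutes_inj[OF p] by (auto dest: injD)
  have upd: "(b \<circ> p)(i := v) = (b(p i := v)) \<circ> p" for b :: "nat \<Rightarrow> nat" and i v
    by (auto simp: fun_eq_iff inj)
  have range: "p i \<in> {1..N} \<longleftrightarrow> i \<in> {1..N}" for i
    using permutes_in_image[OF p] .
  have p': "p permutes {..N}"
    by (rule permutes_subset[OF p]) auto
  have range': "p i \<le> N \<longleftrightarrow> i \<le> N" for i
    using permutes_in_image[OF p', of i] by auto
  have "bij_betw (\<lambda>(i, j). (p i, p j)) (contraction_pairs N) (contraction_pairs N)"
  proof (rule bij_betwI[where g = "\<lambda>(i, j). (inv p i, inv p j)"])
    show "(\<lambda>(i, j). (p i, p j)) \<in> contraction_pairs N \<rightarrow> contraction_pairs N"
      using range range' inj by auto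
    have pi: "p (inv p i) = i" for i
      by (rule permutes_inverses(1)[OF p])
    show "(\<lambda>(i, j). (inv p i, inv p j)) \<in> contraction_pairs N \<rightarrow> contraction_pairs N"
    proof clarify
      fix i j assume "i \<le> N" "1 \<le> j" "j \<le> N" "i \<noteq> j"
      then show "inv p i \<le> N \<and> 1 \<le> inv p j \<and> inv p j \<le> N \<and> inv p i \<noteq> inv p j"
        using range[of "inv p j"] range'[of "inv p i"] inj[of "inv p i" "inv p j"] by (simp add: pi)
    qed
  qed (auto simp: permutes_inverses[OF p])
  then have reindex: "(\<Sum>(i, j) \<in> contraction_pairs N. h (p i) (p j)) = (\<Sum>(i, j) \<in> contraction_pairs N. h i j)"
    for h :: "nat \<Rightarrow> nat \<Rightarrow> real"
    using sum.reindex_bij_betw[of "\<lambda>(i, j). (p i, p j)" _ _ "\<lambda>(i, j). h i j"]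
    by (simp add: case_prod_unfold)
  show ?case
    unfolding contracted_product.simps
      reindex[of "\<lambda>i j. heaviside (s i - s j) * real (a j) *
        contracted_product N s g k (c(i := Suc (c i))) (a(j := a j - 1)) x y", symmetric]
    by (intro sum.cong refl, clarify) (simp only: upd Suc.IH comp_apply)
qed

lemma contraction_number_permute:
  assumes p: "p permutes {1..N}"
  shows "contraction_number N (s \<circ> p) (d \<circ> p) (a \<circ> p) = contraction_number N s d a"
proof -
  have "(\<Sum>j = 1..N. (a \<circ> p) j) = (\<Sum>j = 1..N. a j)"
    using sum.permute[OF p, of a] by simp
  then show ?thesis
    unfolding contraction_number_eq
    using contracted_product_permute[OF p, of s "\<lambda>i x. x ^ d i" "\<Sum>j = 1..N. a j" "\<lambda>_. 0" a "\<lambda>_. 0" "\<lambda>_. 0"]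
    by (simp add: o_def)
qed

section \<open>Integration over the times\<close>

abbreviation times_measure :: "nat \<Rightarrow> (nat \<Rightarrow> real) measure" where
  "times_measure N \<equiv> PiM {1..N} (\<lambda>_. lborel)"

interpretation lborel_product: product_sigma_finite "\<lambda>_ :: nat. lborel :: real measure"
  by standard

lemma measurable_time:
  assumes "i \<le> N"
  shows "(\<lambda>s. (s(0 := t)) i) \<in> borel_measurable (times_measure N)"
proof (cases "i = 0")
  case False
  with assms have "i \<in> {1..N}" by auto
  then have "(\<lambda>s. s i) \<in> measurable (times_measure N) lborel"
    by (rule measurable_component_singleton)
  with False show ?thesis by simp
qed simp

lemma heaviside_measurable: "heaviside \<in> borel_measurable borel"
proof -
  have *: "heaviside = indicator {0<..}"
    by (auto simp: heaviside_def indicator_def)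
  show ?thesis
    unfolding * by (rule borel_measurable_indicator) simp
qed

text \<open>As a function of the times, the integrand is a combination of products of Heaviside functions,
  hence measurable and bounded on the cube. Integrability is what allows the time integral to be
  exchanged with the finite sums.\<close>

lemma set_integrable_contracted_product:
  "set_integrable (times_measure N) ({1..N} \<rightarrow>\<^sub>E {0..T})
     (\<lambda>s. contracted_product N (s(0 := t)) g k c a x y)"
proof (induction k arbitrary: c a)
  case 0
  have "emeasure (times_measure N) ({1..N} \<rightarrow>\<^sub>E {0..T}) = (\<Prod>i = 1..N. emeasure lborel {0..T})"
    by (rule lborel_product.emeasure_PiM) auto
  also have "\<dots> < \<infinity>"
    by (simp add: emeasure_lborel_Icc_eq power_less_top_ennreal)
  finally show ?case
    unfolding set_integrable_def contracted_product.simps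
    by (intro integrable_scaleR_left integrable_real_indicator) auto
next
  case (Suc k)
  let ?A = "{1..N} \<rightarrow>\<^sub>E {0..T}"
  have "integrable (times_measure N) (\<lambda>s. indicator ?A s *\<^sub>R
      (heaviside ((s(0 := t)) i - (s(0 := t)) j) * real (a j) *
        contracted_product N (s(0 := t)) g k (c(i := Suc (c i))) (a(j := a j - 1)) x y))"
    if ij: "(i, j) \<in> contraction_pairs N" for i j
  proof -
    let ?E = "\<lambda>s. indicator ?A s *\<^sub>R contracted_product N (s(0 := t)) g k (c(i := Suc (c i))) (a(j := a j - 1)) x y"
    have int: "integrable (times_measure N) ?E"
      using Suc.IH unfolding set_integrable_def .
    have H: "(\<lambda>s. heaviside ((s(0 := t)) i - (s(0 := t)) j)) \<in> borel_measurable (times_measure N)"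
      by (rule measurable_compose[OF borel_measurable_diff heaviside_measurable])
        (use ij in \<open>auto intro!: measurable_time simp del: fun_upd_apply One_nat_def\<close>)
    have "integrable (times_measure N) (\<lambda>s. real (a j) * (heaviside ((s(0 := t)) i - (s(0 := t)) j) * ?E s))"
    proof (rule integrable_mult_right, rule Bochner_Integration.integrable_bound[OF int])
      show "(\<lambda>s. heaviside ((s(0 := t)) i - (s(0 := t)) j) * ?E s) \<in> borel_measurable (times_measure N)"
        by (rule borel_measurable_times[OF H borel_measurable_integrable[OF int]])
    qed (auto simp: heaviside_def)
    then show ?thesis
      by (simp add: mult_ac)
  qed
  then show ?case
    unfolding set_integrable_def contracted_product.simps case_prod_unfold scaleR_sum_right
    by (intro Bochner_Integration.integrable_sum) (auto simp del: fun_upd_apply)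
qed

definition contraction_integral :: "real \<Rightarrow> real \<Rightarrow> nat \<Rightarrow> (nat \<Rightarrow> nat) \<Rightarrow> (nat \<Rightarrow> nat) \<Rightarrow> real" where
  "contraction_integral T t N d a = time_integral T t N (\<lambda>s. contraction_number N s d a)"

lemma set_integrable_contraction_number:
  "set_integrable (times_measure N) ({1..N} \<rightarrow>\<^sub>E {0..T}) (\<lambda>s. contraction_number N (s(0 := t)) d a)"
  unfolding contraction_number_eq by (intro set_integrable_divide set_integrable_contracted_product)

lemma time_integral_sum:
  "time_integral T t N (\<lambda>s. \<Sum>q\<in>Q. w q * contraction_number N s (d q) (a q))
     = (\<Sum>q\<in>Q. w q * contraction_integral T t N (d q) (a q))"
proof -
  have "integrable (times_measure N) (\<lambda>s. w q * (indicator ({1..N} \<rightarrow>\<^sub>E {0..T}) s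
      * contraction_number N (s(0 := t)) (d q) (a q)))" for q
    using set_integrable_contraction_number[of N T t "d q" "a q"] unfolding set_integrable_def by simp
  then show ?thesis
    unfolding contraction_integral_def time_integral_def set_lebesgue_integral_def
    by (simp add: sum_distrib_left mult.left_commute)
qed

text \<open>The image measure agrees with the product measure on boxes, which determines it.\<close>

lemma times_measure_permute:
  assumes p: "p permutes {1..N}"
  shows "distr (times_measure N) (times_measure N) (\<lambda>s. \<lambda>i\<in>{1..N}. s (p i)) = times_measure N"
proof (rule lborel_product.PiM_eqI)
  have meas: "(\<lambda>s. \<lambda>i\<in>{1..N}. s (p i)) \<in> measurable (times_measure N) (times_measure N)"
    by (intro measurable_restrict measurable_component_singleton) (simp only: permutes_in_image[OF p])
  fix A :: "nat \<Rightarrow> real set"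
  assume A: "\<And>i. i \<in> {1..N} \<Longrightarrow> A i \<in> sets lborel"
  have inv: "inv p i \<in> {1..N}" if "i \<in> {1..N}" for i
    using permutes_in_image[OF permutes_inv[OF p]] that by blast
  have "(\<lambda>s. \<lambda>i\<in>{1..N}. s (p i)) -` Pi\<^sub>E {1..N} A \<inter> space (times_measure N)
      = Pi\<^sub>E {1..N} (\<lambda>i. A (inv p i))" (is "?L = ?R")
  proof (rule set_eqI)
    fix s
    have "(\<forall>i\<in>{1..N}. s (p i) \<in> A i) \<longleftrightarrow> (\<forall>i\<in>{1..N}. s i \<in> A (inv p i))"
      by (metis permutes_in_image[OF p] permutes_inverses[OF p])
    then show "s \<in> ?L \<longleftrightarrow> s \<in> ?R"
      by (auto simp: space_PiM PiE_iff)
  qed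
  then have "emeasure (distr (times_measure N) (times_measure N) (\<lambda>s. \<lambda>i\<in>{1..N}. s (p i))) (Pi\<^sub>E {1..N} A)
      = emeasure (times_measure N) (Pi\<^sub>E {1..N} (\<lambda>i. A (inv p i)))"
    by (subst emeasure_distr[OF meas]) (use A in \<open>auto intro!: sets_PiM_I_finite\<close>)
  also have "\<dots> = (\<Prod>i = 1..N. emeasure lborel (A (inv p i)))"
    by (rule lborel_product.emeasure_PiM) (use A inv in auto)
  also have "\<dots> = (\<Prod>i = 1..N. emeasure lborel (A i))"
    using prod.permute[OF permutes_inv[OF p], of "\<lambda>i. emeasure lborel (A i)"] by (simp add: o_def)
  finally show "emeasure (distr (times_measure N) (times_measure N) (\<lambda>s. \<lambda>i\<in>{1..N}. s (p i))) (Pi\<^sub>E {1..N} A)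
      = (\<Prod>i = 1..N. emeasure lborel (A i))" .
qed auto

lemma contraction_integral_permute:
  assumes p: "p permutes {1..N}"
  shows "contraction_integral T t N (d \<circ> p) (a \<circ> p) = contraction_integral T t N d a"
proof -
  let ?A = "{1..N} \<rightarrow>\<^sub>E {0..T}"
  let ?\<phi> = "\<lambda>s. \<lambda>i\<in>{1..N}. s (p i)"
  let ?F = "\<lambda>s. indicator ?A s *\<^sub>R contraction_number N (s(0 := t)) (d \<circ> p) (a \<circ> p)"
  have meas: "?\<phi> \<in> measurable (times_measure N) (times_measure N)"
    by (intro measurable_restrict measurable_component_singleton) (simp only: permutes_in_image[OF p])
  have p0: "p 0 = 0"
    using permutes_not_in[OF p] by simp
  have "?F (?\<phi> s) = indicator ?A s *\<^sub>R contraction_number N (s(0 := t)) d a"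
    if "s \<in> space (times_measure N)" for s
  proof -
    have "(\<forall>i\<in>{1..N}. s (p i) \<in> {0..T}) \<longleftrightarrow> (\<forall>i\<in>{1..N}. s i \<in> {0..T})"
      by (metis permutes_in_image[OF p] permutes_inverses[OF p])
    then have "?\<phi> s \<in> ?A \<longleftrightarrow> s \<in> ?A"
      using that by (auto simp: space_PiM PiE_iff)
    moreover have "contraction_number N ((?\<phi> s)(0 := t)) (d \<circ> p) (a \<circ> p)
        = contraction_number N (s(0 := t) \<circ> p) (d \<circ> p) (a \<circ> p)"
    proof (rule contraction_number_cong)
      fix i assume "i \<le> N"
      then show "((?\<phi> s)(0 := t)) i = (s(0 := t) \<circ> p) i"
        using p0 permutes_in_image[OF p, of i] by (cases "i = 0") auto
    qed auto
    ultimately show ?thesis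
      unfolding contraction_number_permute[OF p] by (simp add: indicator_def)
  qed
  then have "(LINT s|times_measure N. ?F (?\<phi> s))
      = (LINT s|times_measure N. indicator ?A s *\<^sub>R contraction_number N (s(0 := t)) d a)"
    by (intro Bochner_Integration.integral_cong) auto
  moreover have "(LINT s|times_measure N. ?F (?\<phi> s))
      = (LINT s|distr (times_measure N) (times_measure N) ?\<phi>. ?F s)"
    using set_integrable_contraction_number[of N T t "d \<circ> p" "a \<circ> p"]
    by (intro integral_distr[symmetric] meas)
      (simp add: set_integrable_def borel_measurable_integrable del: real_scaleR_def)
  ultimately show ?thesis
    unfolding times_measure_permute[OF p] contraction_integral_def time_integral_def
      set_lebesgue_integral_def by simp
qed

section \<open>Lists of factors and multi-indices\<close>

lemma contraction_integral_cong:
  assumes "\<And>i. i \<le> N \<Longrightarrow> d i = d' i" and "\<And>j. j \<in> {1..N} \<Longrightarrow> a j = a' j"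
  shows "contraction_integral T t N d a = contraction_integral T t N d' a'"
  unfolding contraction_integral_def
  using contraction_number_cong[of N s s d d' a a' for s] assms by simp

fun ordered_factor :: "factor \<Rightarrow> bool" where
  "ordered_factor (Alpha n) = True"
| "ordered_factor (Beta k1 k2) = (k1 \<le> k2)"

text \<open>Vertex \<open>0\<close> is the root \<open>x\<^sub>0\<^sup>m\<close>, and vertex \<open>i \<ge> 1\<close> is the list entry at position \<open>i - 1\<close>.\<close>

definition x_exponents :: "nat \<Rightarrow> factor list \<Rightarrow> nat \<Rightarrow> nat" where
  "x_exponents m fs i = (if i = 0 then m else x_exponent (fs ! (i - 1)))"

definition y_exponents :: "factor list \<Rightarrow> nat \<Rightarrow> nat" where
  "y_exponents fs j = y_exponent (fs ! (j - 1))"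

definition factors_integral :: "real \<Rightarrow> real \<Rightarrow> nat \<Rightarrow> factor list \<Rightarrow> real" where
  "factors_integral T t m fs =
     contraction_integral T t (length fs) (x_exponents m fs) (y_exponents fs)"

definition multi_index_of :: "nat \<Rightarrow> factor list \<Rightarrow> multi_index" where
  "multi_index_of m fs = Multi_Index (\<lambda>n. count_list fs (Alpha n))
     (\<lambda>(k1, k2). count_list fs (Beta k1 k2)) (\<lambda>n. if n = m then 1 else 0)"

text \<open>Permuting a list permutes the vertices other than the root. This makes the realization of a
  multi-index independent of the enumeration that was chosen for it.\<close>

lemma factors_integral_cong_mset:
  assumes "mset fs = mset fs'"
  shows "factors_integral T t m fs = factors_integral T t m fs'"
proof -
  define N where "N = length fs"
  have N: "length fs = N" "length fs' = N"
    using mset_eq_length[OF assms] by (auto simp: N_def)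
  have enum: "image_mset (\<lambda>i. gs ! (i - 1)) (mset_set {1..N}) = mset gs"
    if "length gs = N" for gs :: "factor list"
  proof -
    have "map (\<lambda>i. gs ! (i - 1)) [1..<Suc N] = gs"
      using that by (auto intro!: nth_equalityI simp: nth_append simp del: upt_Suc)
    then have "mset gs = image_mset (\<lambda>i. gs ! (i - 1)) (mset [1..<Suc N])"
      by (metis mset_map)
    also have "mset [1..<Suc N] = mset_set {1..N}"
      by (simp add: atLeastLessThanSuc_atLeastAtMost del: upt_Suc)
    finally show ?thesis by simp
  qed
  obtain p where p: "p permutes {1..N}"
    and eq: "\<forall>i\<in>{1..N}. fs ! (i - 1) = fs' ! (p i - 1)"
    by (rule image_mset_eq_implies_permutes[of "{1..N}" "\<lambda>i. fs ! (i - 1)" "\<lambda>i. fs' ! (i - 1)"])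
      (use enum N assms in auto)
  have x: "x_exponents m fs i = (x_exponents m fs' \<circ> p) i" if "i \<le> N" for i
  proof (cases "i = 0")
    case True
    then show ?thesis using permutes_not_in[OF p] by (simp add: x_exponents_def)
  next
    case False
    with that have i: "i \<in> {1..N}" by auto
    then have "p i \<in> {1..N}" using permutes_in_image[OF p] by blast
    with eq i show ?thesis by (auto simp: x_exponents_def)
  qed
  have y: "y_exponents fs j = (y_exponents fs' \<circ> p) j" if "j \<in> {1..N}" for j
    using eq that by (simp add: y_exponents_def)
  show ?thesis
    unfolding factors_integral_def N
    by (rule trans[OF contraction_integral_cong[OF x y] contraction_integral_permute[OF p]])
qed

lemma enumerates_iff_mset:
  assumes "enumerates fs \<gamma>"
  shows "enumerates fs' \<gamma> \<longleftrightarrow> mset fs' = mset fs"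
proof
  assume "enumerates fs' \<gamma>"
  with assms have "count_list fs' \<phi> = count_list fs \<phi>" for \<phi>
    by (cases \<phi>) (auto simp: enumerates_def)
  then show "mset fs' = mset fs"
    by (simp add: multiset_eq_iff count_mset)
next
  assume "mset fs' = mset fs"
  then have "count_list fs' \<phi> = count_list fs \<phi>" for \<phi>
    by (simp flip: count_mset)
  then show "enumerates fs' \<gamma>"
    using assms by (simp add: enumerates_def)
qed

lemma enumerates_multi_index_of: "enumerates fs (multi_index_of m fs)"
  by (simp add: enumerates_def multi_index_of_def)

text \<open>The fibre of \<open>multi_index_of\<close> over a multi-index consists of the rearrangements of one list.\<close>

lemma multi_index_of_eq_iff:
  "multi_index_of m' fs' = multi_index_of m fs \<longleftrightarrow> m' = m \<and> mset fs' = mset fs"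
proof
  assume eq: "multi_index_of m' fs' = multi_index_of m fs"
  then have "(\<lambda>n. if n = m' then 1 else 0 :: nat) = (\<lambda>n. if n = m then 1 else 0)"
    by (simp add: multi_index_of_def)
  then have "m' = m"
    by (metis zero_neq_one)
  moreover have "mset fs' = mset fs"
    using enumerates_iff_mset enumerates_multi_index_of eq by metis
  ultimately show "m' = m \<and> mset fs' = mset fs" ..
next
  assume *: "m' = m \<and> mset fs' = mset fs"
  then have "count_list fs' \<phi> = count_list fs \<phi>" for \<phi>
    by (simp flip: count_mset)
  with * show "multi_index_of m' fs' = multi_index_of m fs"
    by (simp add: multi_index_of_def)
qed

lemma realization_multi_index_of:
  "realization T t (multi_index_of m fs) = factors_integral T t m fs"
proof -
  have root: "(THE n. mi_root (multi_index_of m fs) n = 1) = m"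
    by (rule the_equality) (auto simp: multi_index_of_def split: if_splits)
  define gs where "gs = (SOME gs. enumerates gs (multi_index_of m fs))"
  have "enumerates gs (multi_index_of m fs)"
    unfolding gs_def using enumerates_multi_index_of by (rule someI)
  then have "mset gs = mset fs"
    using enumerates_iff_mset[OF enumerates_multi_index_of] by blast
  then have "factors_integral T t m gs = factors_integral T t m fs"
    by (rule factors_integral_cong_mset)
  moreover have "(\<lambda>x y :: nat \<Rightarrow> real. (\<Prod>i\<le>N. x i ^ x_exponents m gs i) * (\<Prod>j = 1..N. y j ^ y_exponents gs j))
    = (\<lambda>x y. x 0 ^ m * (\<Prod>i = 1..N. y i ^ y_exponent (gs ! (i - 1)) * x i ^ x_exponent (gs ! (i - 1))))"
    for N
  proof (intro ext)
    fix x y :: "nat \<Rightarrow> real"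
    have "(\<Prod>i\<le>N. x i ^ x_exponents m gs i) = x 0 ^ m * (\<Prod>i = 1..N. x i ^ x_exponent (gs ! (i - 1)))"
      unfolding atMost_atLeast0
      by (subst prod.atLeast_Suc_atMost) (auto simp: x_exponents_def intro!: prod.cong)
    then show "(\<Prod>i\<le>N. x i ^ x_exponents m gs i) * (\<Prod>j = 1..N. y j ^ y_exponents gs j)
      = x 0 ^ m * (\<Prod>i = 1..N. y i ^ y_exponent (gs ! (i - 1)) * x i ^ x_exponent (gs ! (i - 1)))"
      by (simp add: prod.distrib y_exponents_def)
  qed
  ultimately show ?thesis
    unfolding realization_def root gs_def[symmetric] Let_def
    by (simp only: factors_integral_def contraction_integral_def contraction_number_def)
qed

lemma set_factors:
  "set fs = Alpha ` {n. count_list fs (Alpha n) \<noteq> 0}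
     \<union> (\<lambda>(k1, k2). Beta k1 k2) ` {(k1, k2). count_list fs (Beta k1 k2) \<noteq> 0}"
proof (rule set_eqI)
  fix \<phi>
  show "\<phi> \<in> set fs \<longleftrightarrow> \<phi> \<in> Alpha ` {n. count_list fs (Alpha n) \<noteq> 0}
     \<union> (\<lambda>(k1, k2). Beta k1 k2) ` {(k1, k2). count_list fs (Beta k1 k2) \<noteq> 0}"
    by (cases \<phi>) (auto simp: count_list_0_iff image_iff)
qed

lemma finite_Alpha_support: "finite {n. count_list fs (Alpha n) \<noteq> 0}"
proof (rule finite_imageD)
  show "finite (Alpha ` {n. count_list fs (Alpha n) \<noteq> 0})"
    by (rule finite_subset[of _ "set fs"]) (auto simp: count_list_0_iff)
qed (auto intro: inj_onI)

lemma finite_Beta_support: "finite {(k1, k2). count_list fs (Beta k1 k2) \<noteq> 0}"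
proof (rule finite_imageD)
  show "finite ((\<lambda>(k1, k2). Beta k1 k2) ` {(k1, k2). count_list fs (Beta k1 k2) \<noteq> 0})"
    by (rule finite_subset[of _ "set fs"]) (auto simp: count_list_0_iff)
qed (auto intro: inj_onI)

lemma
  shows sum_set_factors: "(\<Sum>\<phi>\<in>set fs. h \<phi> :: nat) =
      (\<Sum>n | count_list fs (Alpha n) \<noteq> 0. h (Alpha n)) +
      (\<Sum>(k1, k2) \<in> {(k1, k2). count_list fs (Beta k1 k2) \<noteq> 0}. h (Beta k1 k2))"
    and prod_set_factors: "(\<Prod>\<phi>\<in>set fs. w \<phi> :: real) =
      (\<Prod>n | count_list fs (Alpha n) \<noteq> 0. w (Alpha n)) *
      (\<Prod>(k1, k2) \<in> {(k1, k2). count_list fs (Beta k1 k2) \<noteq> 0}. w (Beta k1 k2))"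
proof -
  let ?A = "{n. count_list fs (Alpha n) \<noteq> 0}"
  let ?B = "{(k1, k2). count_list fs (Beta k1 k2) \<noteq> 0}"
  let ?\<beta> = "\<lambda>(k1, k2). Beta k1 k2"
  have inj: "inj_on Alpha ?A" "inj_on ?\<beta> ?B"
    by (auto intro: inj_onI)
  have fin: "finite (Alpha ` ?A)" "finite (?\<beta> ` ?B)"
    by (intro finite_imageI finite_Alpha_support finite_Beta_support)+
  have disj: "Alpha ` ?A \<inter> ?\<beta> ` ?B = {}"
    by auto
  have "(\<Sum>\<phi>\<in>set fs. h \<phi>) = sum h (Alpha ` ?A) + sum h (?\<beta> ` ?B)"
    by (subst set_factors) (rule sum.union_disjoint[OF fin disj])
  then show "(\<Sum>\<phi>\<in>set fs. h \<phi>) = (\<Sum>n\<in>?A. h (Alpha n)) + (\<Sum>(k1, k2)\<in>?B. h (Beta k1 k2))"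
    unfolding sum.reindex[OF inj(1)] sum.reindex[OF inj(2)] by (simp only: o_def case_prod_unfold)
  have "(\<Prod>\<phi>\<in>set fs. w \<phi>) = prod w (Alpha ` ?A) * prod w (?\<beta> ` ?B)"
    by (subst set_factors) (rule prod.union_disjoint[OF fin disj])
  then show "(\<Prod>\<phi>\<in>set fs. w \<phi>) = (\<Prod>n\<in>?A. w (Alpha n)) * (\<Prod>(k1, k2)\<in>?B. w (Beta k1 k2))"
    unfolding prod.reindex[OF inj(1)] prod.reindex[OF inj(2)] by (simp only: o_def case_prod_unfold)
qed

lemma support_multi_index_of:
  "{n. mi_alpha (multi_index_of m fs) n \<noteq> 0} = {n. count_list fs (Alpha n) \<noteq> 0}"
  "{k. mi_beta (multi_index_of m fs) k \<noteq> 0} = {(k1, k2). count_list fs (Beta k1 k2) \<noteq> 0}"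
  by (auto simp: multi_index_of_def)

lemma mi_order_multi_index_of: "mi_order (multi_index_of m fs) = length fs"
proof -
  have "mi_order (multi_index_of m fs) = (\<Sum>\<phi>\<in>set fs. count_list fs \<phi>)"
    unfolding mi_order_def support_multi_index_of sum_set_factors
    by (simp add: multi_index_of_def case_prod_unfold)
  also have "\<dots> = length fs"
    by (simp add: sum_count_set)
  finally show ?thesis .
qed

lemma multi_index_of_in_feynman_multi_indices:
  assumes "\<And>\<phi>. \<phi> \<in> set fs \<Longrightarrow> ordered_factor \<phi>"
  shows "multi_index_of m fs \<in> feynman_multi_indices"
proof -
  have "k1 \<le> k2" if "count_list fs (Beta k1 k2) \<noteq> 0" for k1 k2
    using assms[of "Beta k1 k2"] that by (auto simp: count_list_0_iff)
  then show ?thesis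
    unfolding feynman_multi_indices_def
    by (auto simp only: mem_Collect_eq support_multi_index_of finite_Alpha_support finite_Beta_support)
       (auto simp: multi_index_of_def)
qed

text \<open>A finitely supported multi-index is the multiset of its factors, and any multiset can be listed.\<close>

lemma feynman_multi_indexE:
  assumes "\<gamma> \<in> feynman_multi_indices"
  obtains m fs where "\<gamma> = multi_index_of m fs" and "\<And>\<phi>. \<phi> \<in> set fs \<Longrightarrow> ordered_factor \<phi>"
proof -
  obtain m where m: "\<And>n. mi_root \<gamma> n = (if n = m then 1 else 0)"
    and fin: "finite {n. mi_alpha \<gamma> n \<noteq> 0}" "finite {k. mi_beta \<gamma> k \<noteq> 0}"
    and ord: "\<And>k1 k2. mi_beta \<gamma> (k1, k2) \<noteq> 0 \<Longrightarrow> k1 \<le> k2"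
    using assms unfolding feynman_multi_indices_def by blast
  define c where "c \<phi> = (case \<phi> of Alpha n \<Rightarrow> mi_alpha \<gamma> n | Beta k1 k2 \<Rightarrow> mi_beta \<gamma> (k1, k2))" for \<phi>
  have "\<phi> \<in> Alpha ` {n. mi_alpha \<gamma> n \<noteq> 0} \<union> (\<lambda>(k1, k2). Beta k1 k2) ` {k. mi_beta \<gamma> k \<noteq> 0}"
    if "0 < c \<phi>" for \<phi>
    using that by (cases \<phi>) (auto simp: c_def image_iff)
  then have "finite {\<phi>. 0 < c \<phi>}"
    using fin by (intro finite_subset[of "{\<phi>. 0 < c \<phi>}" "Alpha ` {n. mi_alpha \<gamma> n \<noteq> 0}
      \<union> (\<lambda>(k1, k2). Beta k1 k2) ` {k. mi_beta \<gamma> k \<noteq> 0}"]) auto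
  then have count: "count (Abs_multiset c) = c"
    by (rule count_Abs_multiset)
  obtain fs where "mset fs = Abs_multiset c"
    using ex_mset by blast
  with count have fs: "count_list fs \<phi> = c \<phi>" for \<phi>
    by (simp flip: count_mset)
  have "\<gamma> = multi_index_of m fs"
    by (cases \<gamma>) (use m in \<open>auto simp: multi_index_of_def fs c_def fun_eq_iff\<close>)
  moreover have "ordered_factor \<phi>" if "\<phi> \<in> set fs" for \<phi>
  proof -
    have "c \<phi> \<noteq> 0"
      using that fs[of \<phi>] count_list_0_iff[of fs \<phi>] by metis
    then show ?thesis
      using ord by (cases \<phi>) (auto simp: c_def)
  qed
  ultimately show thesis
    using that by blast
qed

text \<open>The Taylor coefficient with which a factor occurs in a single vertex of the functional. The
  denominator \<open>2\<close> on the diagonal is the \<open>1/2\<close> in front of \<open>\<beta>\<^sup>2\<close>; off the diagonal it is compensated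
  by the two orders of \<open>k\<^sub>1\<close> and \<open>k\<^sub>2\<close>.\<close>

fun factor_weight :: "(real \<Rightarrow> real) \<Rightarrow> (real \<Rightarrow> real) \<Rightarrow> real \<Rightarrow> factor \<Rightarrow> real" where
  "factor_weight \<alpha> \<beta> u (Alpha n) = (deriv ^^ n) \<alpha> u / fact n"
| "factor_weight \<alpha> \<beta> u (Beta k1 k2) =
     (deriv ^^ k1) \<beta> u / fact k1 * ((deriv ^^ k2) \<beta> u / fact k2) / (if k1 = k2 then 2 else 1)"

lemma two_power_diagonal:
  assumes "finite {k :: nat \<times> nat. b k \<noteq> 0}"
  shows "(2::real) ^ (\<Sum>i | b (i, i) \<noteq> 0. b (i, i))
    = (\<Prod>(k1, k2) \<in> {k. b k \<noteq> 0}. (if k1 = k2 then 2 else 1) ^ b (k1, k2))"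
proof -
  have "(2::real) ^ (\<Sum>i | b (i, i) \<noteq> 0. b (i, i)) = (\<Prod>i | b (i, i) \<noteq> 0. 2 ^ b (i, i))"
    by (simp add: power_sum)
  also have "\<dots> = (\<Prod>k \<in> (\<lambda>i. (i, i)) ` {i. b (i, i) \<noteq> 0}. 2 ^ b k)"
    by (subst prod.reindex) (auto intro: inj_onI)
  also have "\<dots> = (\<Prod>k \<in> (\<lambda>i. (i, i)) ` {i. b (i, i) \<noteq> 0}. (if fst k = snd k then 2 else 1) ^ b k)"
    by (intro prod.cong) auto
  also have "\<dots> = (\<Prod>k | b k \<noteq> 0. (if fst k = snd k then 2 else 1) ^ b k)"
    by (rule prod.mono_neutral_left) (use assms in auto)
  finally show ?thesis by (simp add: case_prod_unfold)
qed

text \<open>The symmetry factor collects three things: the factorials of Taylor's formula and the powers of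
  \<open>2\<close> for the diagonal \<open>\<beta>\<close> factors, which combine with the elementary differential to the weights, and
  the factorials of the multiplicities.\<close>

lemma elementary_differential_over_symmetry_factor:
  "elementary_differential \<alpha> \<beta> f u (multi_index_of m fs) / real (symmetry_factor (multi_index_of m fs))
    = (deriv ^^ m) f u / fact m *
      (\<Prod>\<phi>\<in>set fs. factor_weight \<alpha> \<beta> u \<phi> ^ count_list fs \<phi> / fact (count_list fs \<phi>))"
proof -
  let ?\<gamma> = "multi_index_of m fs"
  let ?A = "{n. count_list fs (Alpha n) \<noteq> 0}"
  let ?B = "{(k1, k2). count_list fs (Beta k1 k2) \<noteq> 0}"
  let ?a = "\<lambda>n. count_list fs (Alpha n)"
  let ?b = "\<lambda>k1 k2. count_list fs (Beta k1 k2)"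
  let ?r = "\<lambda>n. if n = m then 1 else 0 :: nat"
  have S: "{n. mi_alpha ?\<gamma> n \<noteq> 0 \<or> mi_root ?\<gamma> n \<noteq> 0} = insert m ?A"
    by (auto simp: multi_index_of_def)
  have finA: "finite (insert m ?A)" and finB: "finite ?B"
    using finite_Alpha_support finite_Beta_support by auto
  have "(\<Prod>n\<in>insert m ?A. (deriv ^^ n) \<alpha> u ^ ?a n * (deriv ^^ n) f u ^ ?r n) /
      (\<Prod>n\<in>insert m ?A. fact (?a n) * fact n ^ (?a n + ?r n))
    = (\<Prod>n\<in>insert m ?A. (factor_weight \<alpha> \<beta> u (Alpha n) ^ ?a n / fact (?a n)) *
        (if n = m then (deriv ^^ m) f u / fact m else 1))"
    unfolding prod_dividef[symmetric]
    by (intro prod.cong) (auto simp: power_divide power_add field_simps)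
  also have "\<dots> = (\<Prod>n\<in>insert m ?A. factor_weight \<alpha> \<beta> u (Alpha n) ^ ?a n / fact (?a n)) *
        ((deriv ^^ m) f u / fact m)"
    using finA by (simp only: prod.distrib prod.delta[OF finA] insertI1 if_True)
  also have "(\<Prod>n\<in>insert m ?A. factor_weight \<alpha> \<beta> u (Alpha n) ^ ?a n / fact (?a n))
      = (\<Prod>n\<in>?A. factor_weight \<alpha> \<beta> u (Alpha n) ^ ?a n / fact (?a n))"
    by (rule prod.mono_neutral_right) (use finA in auto)
  finally have alpha: "(\<Prod>n\<in>insert m ?A. (deriv ^^ n) \<alpha> u ^ ?a n * (deriv ^^ n) f u ^ ?r n) /
      (\<Prod>n\<in>insert m ?A. fact (?a n) * fact n ^ (?a n + ?r n))
    = (deriv ^^ m) f u / fact m * (\<Prod>n\<in>?A. factor_weight \<alpha> \<beta> u (Alpha n) ^ ?a n / fact (?a n))"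
    by simp
  have beta: "(\<Prod>(k1, k2)\<in>?B. ((deriv ^^ k1) \<beta> u * (deriv ^^ k2) \<beta> u) ^ ?b k1 k2) /
      ((\<Prod>(k1, k2)\<in>?B. fact (?b k1 k2) * (fact k1 * fact k2) ^ ?b k1 k2) *
       (\<Prod>(k1, k2)\<in>?B. (if k1 = k2 then 2 else 1) ^ ?b k1 k2))
    = (\<Prod>(k1, k2)\<in>?B. factor_weight \<alpha> \<beta> u (Beta k1 k2) ^ ?b k1 k2 / fact (?b k1 k2))"
    unfolding prod_dividef[symmetric] prod.distrib[symmetric]
    by (intro prod.cong) (auto simp: power_divide power_mult_distrib field_simps)
  have diag: "(2::real) ^ (\<Sum>i | ?b i i \<noteq> 0. ?b i i)
      = (\<Prod>(k1, k2)\<in>?B. (if k1 = k2 then 2 else 1) ^ ?b k1 k2)"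
    using two_power_diagonal[of "\<lambda>(k1, k2). ?b k1 k2"] finB by (simp add: case_prod_unfold)
  have "elementary_differential \<alpha> \<beta> f u ?\<gamma> =
      (\<Prod>n\<in>insert m ?A. (deriv ^^ n) \<alpha> u ^ ?a n * (deriv ^^ n) f u ^ ?r n) *
      (\<Prod>(k1, k2)\<in>?B. ((deriv ^^ k1) \<beta> u * (deriv ^^ k2) \<beta> u) ^ ?b k1 k2)"
    unfolding elementary_differential_def S support_multi_index_of by (simp add: multi_index_of_def)
  moreover have "real (symmetry_factor ?\<gamma>) =
      (\<Prod>n\<in>insert m ?A. fact (?a n) * fact n ^ (?a n + ?r n)) *
      ((\<Prod>(k1, k2)\<in>?B. fact (?b k1 k2) * (fact k1 * fact k2) ^ ?b k1 k2) *
       (\<Prod>(k1, k2)\<in>?B. (if k1 = k2 then 2 else 1) ^ ?b k1 k2))"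
    unfolding symmetry_factor_def S support_multi_index_of diag[symmetric]
    by (simp add: multi_index_of_def case_prod_unfold mult.assoc)
  ultimately show ?thesis
    unfolding prod_set_factors alpha[symmetric] mult.assoc[symmetric] beta[symmetric]
    by (simp only: times_divide_times_eq mult.assoc alpha[symmetric] beta[symmetric])
qed

section \<open>Expansion of the Martin-Siggia-Rose functional\<close>

text \<open>Folding a symmetric sum at its centre: terms off the centre come in equal pairs, and a possible
  central term is alone.\<close>

lemma sum_symmetric_half:
  fixes h :: "nat \<Rightarrow> real"
  assumes "\<And>k. k \<le> n \<Longrightarrow> h (n - k) = h k"
  shows "(\<Sum>k \<in> {k. k \<le> n - k \<and> k \<le> n}. h k / (if k = n - k then 2 else 1)) = 1 / 2 * (\<Sum>k\<le>n. h k)"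
proof -
  let ?L = "{k. k < n - k}" and ?M = "{k. k = n - k}" and ?U = "{k. n - k < k \<and> k \<le> n}"
  have fin: "finite ?L" "finite ?M" "finite ?U"
    by (auto intro: finite_subset[of _ "{..n}"])
  have disj: "?L \<inter> ?M = {}" "(?L \<union> ?M) \<inter> ?U = {}"
    by auto
  have "{..n} = ?L \<union> ?M \<union> ?U"
    by auto
  then have "(\<Sum>k\<le>n. h k) = sum h ?L + sum h ?M + sum h ?U"
    using fin disj by (simp add: sum.union_disjoint)
  also have "sum h ?U = sum h ?L"
    by (rule sum.reindex_bij_witness[of _ "\<lambda>k. n - k" "\<lambda>k. n - k"]) (use assms in auto)
  finally have "1 / 2 * (\<Sum>k\<le>n. h k) = sum h ?L + sum h ?M / 2"
    by simp
  also have "{k. k \<le> n - k \<and> k \<le> n} = ?L \<union> ?M"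
    by auto
  then have "(\<Sum>k \<in> {k. k \<le> n - k \<and> k \<le> n}. h k / (if k = n - k then 2 else 1))
      = (\<Sum>k\<in>?L. h k / (if k = n - k then 2 else 1)) + (\<Sum>k\<in>?M. h k / (if k = n - k then 2 else 1))"
    using fin disj by (simp add: sum.union_disjoint)
  moreover have "(\<Sum>k\<in>?L. h k / (if k = n - k then 2 else 1)) = sum h ?L"
    by (intro sum.cong) auto
  moreover have "(\<Sum>k\<in>?M. h k / (if k = n - k then 2 else 1)) = sum h ?M / 2"
    unfolding sum_divide_distrib by (intro sum.cong) auto
  ultimately show ?thesis by simp
qed

definition factors_upto :: "nat \<Rightarrow> factor set" where
  "factors_upto B = {\<phi>. ordered_factor \<phi> \<and> x_exponent \<phi> \<le> B}"

lemma finite_factors_upto: "finite (factors_upto B)"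
proof (rule finite_subset)
  show "factors_upto B \<subseteq> Alpha ` {..B} \<union> (\<lambda>(k1, k2). Beta k1 k2) ` ({..B} \<times> {..B})"
  proof
    fix \<phi> assume "\<phi> \<in> factors_upto B"
    then show "\<phi> \<in> Alpha ` {..B} \<union> (\<lambda>(k1, k2). Beta k1 k2) ` ({..B} \<times> {..B})"
      by (cases \<phi>) (auto simp: factors_upto_def image_iff)
  qed
qed auto

text \<open>The factors that reproduce the monomial \<open>y\<^sup>\<epsilon> x\<^sup>n\<close>; their weights add up to its Taylor
  coefficient in \<open>y \<alpha>(x) + y\<^sup>2 \<beta>(x)\<^sup>2 / 2\<close>, as the next lemmas show.\<close>

definition factors_with :: "nat \<Rightarrow> nat \<Rightarrow> factor set" where
  "factors_with \<epsilon> n = {\<phi>. ordered_factor \<phi> \<and> y_exponent \<phi> = \<epsilon> \<and> x_exponent \<phi> = n}"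

lemma finite_factors_with: "finite (factors_with \<epsilon> n)"
  by (rule finite_subset[OF _ finite_factors_upto[of n]]) (auto simp: factors_with_def factors_upto_def)

lemma sum_factors_with_1:
  "(\<Sum>\<phi>\<in>factors_with 1 n. factor_weight \<alpha> \<beta> u \<phi>) = (deriv ^^ n) \<alpha> u / fact n"
proof -
  have "\<phi> \<in> factors_with 1 n \<longleftrightarrow> \<phi> \<in> {Alpha n}" for \<phi>
    by (cases \<phi>) (auto simp: factors_with_def)
  then have "factors_with 1 n = {Alpha n}"
    by blast
  then show ?thesis by simp
qed

lemma sum_factors_with_2:
  assumes "smooth \<beta>"
  shows "(\<Sum>\<phi>\<in>factors_with 2 n. factor_weight \<alpha> \<beta> u \<phi>)
    = 1 / 2 * ((deriv ^^ n) (\<lambda>x. \<beta> x * \<beta> x) u / fact n)"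
proof -
  let ?b = "\<lambda>k. (deriv ^^ k) \<beta> u / fact k"
  have "\<phi> \<in> factors_with 2 n \<longleftrightarrow> \<phi> \<in> (\<lambda>k. Beta k (n - k)) ` {k. k \<le> n - k \<and> k \<le> n}" for \<phi>
    by (cases \<phi>) (auto simp: factors_with_def image_iff)
  then have "factors_with 2 n = (\<lambda>k. Beta k (n - k)) ` {k. k \<le> n - k \<and> k \<le> n}"
    by blast
  then have "(\<Sum>\<phi>\<in>factors_with 2 n. factor_weight \<alpha> \<beta> u \<phi>)
      = (\<Sum>k \<in> {k. k \<le> n - k \<and> k \<le> n}. ?b k * ?b (n - k) / (if k = n - k then 2 else 1))"
    by (simp add: sum.reindex inj_on_def)
  also have "\<dots> = 1 / 2 * (\<Sum>k\<le>n. ?b k * ?b (n - k))"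
    by (rule sum_symmetric_half) (simp add: mult.commute)
  also have "(\<Sum>k\<le>n. ?b k * ?b (n - k)) = (deriv ^^ n) (\<lambda>x. \<beta> x * \<beta> x) u / fact n"
    unfolding higher_deriv_mult[OF assms assms] sum_divide_distrib
    by (intro sum.cong) (auto simp: binomial_fact)
  finally show ?thesis .
qed

lemma prod_sum_lists:
  fixes w :: "'a \<Rightarrow> real"
  assumes "\<And>i. i \<in> {1..N} \<Longrightarrow> finite (X i)"
  shows "(\<Prod>i = 1..N. \<Sum>\<phi>\<in>X i. w \<phi>)
    = (\<Sum>fs | length fs = N \<and> (\<forall>i\<in>{1..N}. fs ! (i - 1) \<in> X i). prod_list (map w fs))"
  using assms
proof (induction N)
  case 0
  have "{fs :: 'a list. length fs = 0 \<and> (\<forall>i\<in>{1..0}. fs ! (i - 1) \<in> X i)} = {[]}"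
    by auto
  then show ?case by simp
next
  case (Suc N)
  let ?L = "\<lambda>N. {fs. length fs = N \<and> (\<forall>i\<in>{1..N}. fs ! (i - 1) \<in> X i)}"
  have "(\<Prod>i = 1..Suc N. \<Sum>\<phi>\<in>X i. w \<phi>) = (\<Sum>fs\<in>?L N. prod_list (map w fs)) * (\<Sum>\<phi>\<in>X (Suc N). w \<phi>)"
    using Suc by (simp add: mult.commute)
  also have "\<dots> = (\<Sum>(fs, \<phi>) \<in> ?L N \<times> X (Suc N). prod_list (map w (fs @ [\<phi>])))"
    by (simp add: sum_product sum.cartesian_product)
  also have "\<dots> = (\<Sum>fs\<in>?L (Suc N). prod_list (map w fs))"
  proof (rule sum.reindex_bij_witness[where i = "\<lambda>fs. (butlast fs, last fs)" and j = "\<lambda>(fs, \<phi>). fs @ [\<phi>]"])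
    fix fs assume "fs \<in> ?L (Suc N)"
    then have len: "length fs = Suc N" and X: "\<And>i. i \<in> {1..Suc N} \<Longrightarrow> fs ! (i - 1) \<in> X i"
      by auto
    show "(case (butlast fs, last fs) of (fs, \<phi>) \<Rightarrow> fs @ [\<phi>]) = fs"
      using len by (cases fs rule: rev_cases) auto
    have "butlast fs ! (i - 1) \<in> X i" if "i \<in> {1..N}" for i
    proof -
      have "butlast fs ! (i - 1) = fs ! (i - 1)"
        by (rule nth_butlast) (use that len in auto)
      then show ?thesis using X[of i] that by simp
    qed
    moreover have "last fs \<in> X (Suc N)"
      using X[of "Suc N"] len by (cases fs rule: rev_cases) (auto simp: nth_append)
    ultimately show "(butlast fs, last fs) \<in> ?L N \<times> X (Suc N)"
      using len by simp
  next
    fix p assume "p \<in> ?L N \<times> X (Suc N)"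
    then obtain fs \<phi> where [simp]: "p = (fs, \<phi>)" and len: "length fs = N"
      and X: "\<And>i. i \<in> {1..N} \<Longrightarrow> fs ! (i - 1) \<in> X i" "\<phi> \<in> X (Suc N)"
      by auto
    have "(fs @ [\<phi>]) ! (i - 1) \<in> X i" if i: "i \<in> {1..Suc N}" for i
    proof (cases "i = Suc N")
      case False
      with i have "i \<in> {1..N}" by auto
      moreover from this len have "(fs @ [\<phi>]) ! (i - 1) = fs ! (i - 1)"
        by (auto simp: nth_append)
      ultimately show ?thesis using X(1) by simp
    qed (use len X(2) in \<open>simp add: nth_append\<close>)
    then show "(case p of (fs, \<phi>) \<Rightarrow> fs @ [\<phi>]) \<in> ?L (Suc N)"
      using len by simp
  qed auto
  finally show ?case .
qed

lemma prod_list_map_eq_prod_count: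
  "prod_list (map w fs) = (\<Prod>\<phi>\<in>set fs. (w \<phi> :: real) ^ count_list fs \<phi>)"
proof -
  have "finite X \<Longrightarrow> set fs \<subseteq> X \<Longrightarrow> prod_list (map w fs) = (\<Prod>\<phi>\<in>X. w \<phi> ^ count_list fs \<phi>)" for X
  proof (induction fs)
    case (Cons \<phi> fs)
    have "(\<Prod>\<psi>\<in>X. w \<psi> ^ count_list (\<phi> # fs) \<psi>)
        = (\<Prod>\<psi>\<in>X. w \<psi> ^ count_list fs \<psi> * (if \<psi> = \<phi> then w \<phi> else 1))"
      by (intro prod.cong) auto
    with Cons show ?case by (simp add: prod.distrib)
  qed simp
  then show ?thesis by blast
qed

definition factor_lists :: "nat \<Rightarrow> nat \<Rightarrow> factor list set" where
  "factor_lists B N = {fs. set fs \<subseteq> factors_upto B \<and> length fs = N}"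

lemma finite_factor_lists: "finite (factor_lists B N)"
  unfolding factor_lists_def by (rule finite_lists_length_eq[OF finite_factors_upto])

lemma prod_atMost_split: "(\<Prod>i\<le>N. h i) = h 0 * (\<Prod>i = 1..N. h i)" for h :: "nat \<Rightarrow> real"
  unfolding atMost_atLeast0 by (subst prod.atLeast_Suc_atMost) auto

lemma exponent_pattern_sum_le:
  assumes "e \<in> {1..N} \<rightarrow>\<^sub>E {1, 2 :: nat}"
  shows "(\<Sum>j = 1..N. e j) \<le> 2 * N"
proof -
  have "e j \<le> 2" if "j \<in> {1..N}" for j
    using PiE_mem[OF assms that] by auto
  then have "(\<Sum>j = 1..N. e j) \<le> (\<Sum>j = 1..N. 2)"
    by (rule sum_mono)
  then show ?thesis by simp
qed

lemma msr_functional_expansion: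
  fixes x y :: "nat \<Rightarrow> real"
  shows "f (x 0) * (\<Prod>i = 1..N. (y i * \<alpha> (x i) + 1 / 2 * (y i)\<^sup>2 * (\<beta> (x i))\<^sup>2)) =
    (\<Sum>e \<in> {1..N} \<rightarrow>\<^sub>E {1, 2}. (\<Prod>i = 1..N. if e i = 1 then 1 else 1 / 2) *
      ((\<Prod>i\<le>N. (if i = 0 then f else if e i = 1 then \<alpha> else (\<lambda>x. \<beta> x * \<beta> x)) (x i)) *
       (\<Prod>j = 1..N. y j ^ e j)))"
proof -
  let ?G = "\<lambda>\<epsilon>. if \<epsilon> = (1::nat) then \<alpha> else (\<lambda>x. \<beta> x * \<beta> x)"
  have "(\<Prod>i = 1..N. (y i * \<alpha> (x i) + 1 / 2 * (y i)\<^sup>2 * (\<beta> (x i))\<^sup>2))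
      = (\<Prod>i = 1..N. \<Sum>\<epsilon>\<in>{1, 2}. (if \<epsilon> = 1 then 1 else 1 / 2) * ?G \<epsilon> (x i) * y i ^ \<epsilon>)"
    by (intro prod.cong) (auto simp: power2_eq_square)
  also have "\<dots> = (\<Sum>e \<in> {1..N} \<rightarrow>\<^sub>E {1, 2}.
      \<Prod>i = 1..N. (if e i = 1 then 1 else 1 / 2) * ?G (e i) (x i) * y i ^ e i)"
    by (rule prod_sum_PiE) auto
  finally show ?thesis
    unfolding prod_atMost_split prod.distrib by (simp add: sum_distrib_left mult_ac)
qed

text \<open>Here \<open>e\<^sub>i \<in> {1, 2}\<close> selects the drift or the diffusion term at vertex \<open>i\<close>, and \<open>d\<^sub>i\<close> is the order
  of its Taylor term. There are at most \<open>2 N\<close> auxiliary fields, so that no Taylor order beyond \<open>2 N\<close>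
  can be contracted.\<close>

lemma msr_expectation_eq_sum_patterns:
  assumes "smooth \<alpha>" and "smooth \<beta>" and "smooth f"
  shows "msr_expectation \<alpha> \<beta> f u T t N = 1 / fact N *
    (\<Sum>(e, d) \<in> ({1..N} \<rightarrow>\<^sub>E {1, 2}) \<times> ({..N} \<rightarrow>\<^sub>E {..2 * N}).
       (deriv ^^ d 0) f u / fact (d 0) *
       (\<Prod>i = 1..N. \<Sum>\<phi>\<in>factors_with (e i) (d i). factor_weight \<alpha> \<beta> u \<phi>) *
       contraction_integral T t N d e)"
proof -
  let ?g = "\<lambda>e i. if i = 0 then f else if e i = 1 then \<alpha> else (\<lambda>x. \<beta> x * \<beta> x)"
  let ?w = "\<lambda>e :: nat \<Rightarrow> nat. \<Prod>i = 1..N. if e i = 1 then 1 else 1 / 2 :: real"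
  let ?E = "{1..N} \<rightarrow>\<^sub>E {1, 2 :: nat}" and ?D = "{..N} \<rightarrow>\<^sub>E {..2 * N}"
  let ?c = "\<lambda>e d. ?w e * (\<Prod>i\<le>N. (deriv ^^ d i) (?g e i) u / fact (d i))"
  have "exp_contraction N s
         (\<lambda>x y. f (x 0) * (\<Prod>i = 1..N. (y i * \<alpha> (x i) + 1 / 2 * (y i)\<^sup>2 * (\<beta> (x i))\<^sup>2)))
         (\<lambda>_. u) (\<lambda>_. 0) = (\<Sum>q \<in> ?E \<times> ?D. ?c (fst q) (snd q) * contraction_number N s (snd q) (fst q))" for s
    unfolding msr_functional_expansion
    by (subst exp_contraction_taylor[where B = "2 * N"])
      (auto simp: assms smooth_mult exponent_pattern_sum_le sum.cartesian_product case_prod_unfold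
        simp del: One_nat_def)
  then have "msr_expectation \<alpha> \<beta> f u T t N = 1 / fact N *
      (\<Sum>q \<in> ?E \<times> ?D. ?c (fst q) (snd q) * contraction_integral T t N (snd q) (fst q))"
    unfolding msr_expectation_def by (simp only: time_integral_sum)
  also have "(\<Sum>q \<in> ?E \<times> ?D. ?c (fst q) (snd q) * contraction_integral T t N (snd q) (fst q))
     = (\<Sum>(e, d) \<in> ?E \<times> ?D. (deriv ^^ d 0) f u / fact (d 0) *
       (\<Prod>i = 1..N. \<Sum>\<phi>\<in>factors_with (e i) (d i). factor_weight \<alpha> \<beta> u \<phi>) *
       contraction_integral T t N d e)"
  proof (intro sum.cong refl, clarify, unfold fst_conv snd_conv)
    fix e d assume e: "e \<in> ?E"
    have "(if e i = 1 then 1 else 1 / 2) * ((deriv ^^ d i) (?g e i) u / fact (d i))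
        = (\<Sum>\<phi>\<in>factors_with (e i) (d i). factor_weight \<alpha> \<beta> u \<phi>)" if i: "i \<in> {1..N}" for i
    proof -
      have "e i = 1 \<or> e i = 2"
        using PiE_mem[OF e i] by auto
      then show ?thesis
        using i sum_factors_with_1 sum_factors_with_2[OF assms(2)] by auto
    qed
    then have "?w e * (\<Prod>i = 1..N. (deriv ^^ d i) (?g e i) u / fact (d i))
        = (\<Prod>i = 1..N. \<Sum>\<phi>\<in>factors_with (e i) (d i). factor_weight \<alpha> \<beta> u \<phi>)"
      unfolding prod.distrib[symmetric] by (intro prod.cong) auto
    then show "?c e d * contraction_integral T t N d e = (deriv ^^ d 0) f u / fact (d 0) *
       (\<Prod>i = 1..N. \<Sum>\<phi>\<in>factors_with (e i) (d i). factor_weight \<alpha> \<beta> u \<phi>) *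
       contraction_integral T t N d e"
      unfolding prod_atMost_split by (simp add: mult_ac)
  qed
  finally show ?thesis .
qed

text \<open>Multiplying out the sums over \<open>factors_with\<close> turns a pair of exponent patterns \<open>(e, d)\<close> into all
  lists of factors with these exponents. Conversely, a root exponent and a list belong to exactly one
  pattern, which the map \<open>G\<close> in the proof reads off; the contraction integral depends on the pattern only.\<close>

lemma msr_expectation_eq_sum_lists:
  assumes "smooth \<alpha>" and "smooth \<beta>" and "smooth f"
  shows "msr_expectation \<alpha> \<beta> f u T t N = 1 / fact N *
    (\<Sum>(m, fs) \<in> {..2 * N} \<times> factor_lists (2 * N) N.
       (deriv ^^ m) f u / fact m * prod_list (map (factor_weight \<alpha> \<beta> u) fs) * factors_integral T t m fs)"
proof -
  let ?E = "{1..N} \<rightarrow>\<^sub>E {1, 2 :: nat}" and ?D = "{..N} \<rightarrow>\<^sub>E {..2 * N}"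
  let ?S = "{..2 * N} \<times> factor_lists (2 * N) N"
  let ?W = "\<lambda>fs. prod_list (map (factor_weight \<alpha> \<beta> u) fs)"
  let ?h = "\<lambda>(m, fs). (deriv ^^ m) f u / fact m * ?W fs * factors_integral T t m fs"
  define G where "G = (\<lambda>(m, fs). (restrict (y_exponents fs) {1..N}, restrict (x_exponents m fs) {..N}))"
  have y12: "y_exponent \<phi> \<in> {1, 2}" for \<phi>
    by (cases \<phi>) auto
  have "G ` ?S \<subseteq> ?E \<times> ?D"
  proof clarify
    fix m fs e d assume *: "fs \<in> factor_lists (2 * N) N" "m \<le> 2 * N" "(e, d) = G (m, fs)"
    have "x_exponent (fs ! (i - 1)) \<le> 2 * N" if "i \<le> N" "i \<noteq> 0" for i
    proof -
      have "fs ! (i - 1) \<in> set fs"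
        using * that by (intro nth_mem) (auto simp: factor_lists_def)
      then show ?thesis
        using * by (auto simp: factor_lists_def factors_upto_def)
    qed
    then show "e \<in> ?E \<and> d \<in> ?D"
      using * y12 by (auto simp: G_def y_exponents_def x_exponents_def)
  qed
  then have "sum ?h ?S = (\<Sum>p \<in> ?E \<times> ?D. \<Sum>q \<in> {q \<in> ?S. G q = p}. ?h q)"
    by (intro sum.group[symmetric]) (auto intro!: finite_PiE simp: finite_factor_lists)
  also have "\<dots> = (\<Sum>(e, d) \<in> ?E \<times> ?D. (deriv ^^ d 0) f u / fact (d 0) *
       (\<Prod>i = 1..N. \<Sum>\<phi>\<in>factors_with (e i) (d i). factor_weight \<alpha> \<beta> u \<phi>) *
       contraction_integral T t N d e)"
  proof (intro sum.cong refl, clarify)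
    fix e d assume e: "e \<in> ?E" and d: "d \<in> ?D"
    let ?L = "{fs. length fs = N \<and> (\<forall>i\<in>{1..N}. fs ! (i - 1) \<in> factors_with (e i) (d i))}"
    have d_le: "d i \<le> 2 * N" if "i \<le> N" for i
      using PiE_mem[OF d, of i] that by auto
    have "(m, fs) \<in> ?S \<and> G (m, fs) = (e, d) \<longleftrightarrow> m = d 0 \<and> fs \<in> ?L" for m fs
    proof
      assume *: "(m, fs) \<in> ?S \<and> G (m, fs) = (e, d)"
      then have len: "length fs = N" and set: "set fs \<subseteq> factors_upto (2 * N)"
        and eq: "restrict (y_exponents fs) {1..N} = e" "restrict (x_exponents m fs) {..N} = d"
        by (auto simp: factor_lists_def G_def)
      have "m = d 0"
        unfolding eq(2)[symmetric] by (simp add: x_exponents_def)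
      moreover have "fs ! (i - 1) \<in> factors_with (e i) (d i)" if "i \<in> {1..N}" for i
      proof -
        have "fs ! (i - 1) \<in> set fs"
          using len that by (intro nth_mem) auto
        then have "ordered_factor (fs ! (i - 1))"
          using set by (auto simp: factors_upto_def)
        then show ?thesis
          unfolding eq[symmetric] factors_with_def using that
          by (auto simp: x_exponents_def y_exponents_def)
      qed
      ultimately show "m = d 0 \<and> fs \<in> ?L"
        using len by simp
    next
      assume *: "m = d 0 \<and> fs \<in> ?L"
      then have len: "length fs = N"
        and mem: "\<And>i. i \<in> {1..N} \<Longrightarrow> fs ! (i - 1) \<in> factors_with (e i) (d i)"
        by auto
      have "\<phi> \<in> factors_upto (2 * N)" if "\<phi> \<in> set fs" for \<phi>
      proof -
        obtain k where k: "k < N" "\<phi> = fs ! k"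
          using \<open>\<phi> \<in> set fs\<close> len by (auto simp: in_set_conv_nth)
        then show ?thesis
          using mem[of "Suc k"] d_le[of "Suc k"] by (auto simp: factors_with_def factors_upto_def)
      qed
      moreover have "restrict (y_exponents fs) {1..N} = e"
      proof
        fix i show "restrict (y_exponents fs) {1..N} i = e i"
          using mem[of i] PiE_arb[OF e, of i] by (auto simp: factors_with_def y_exponents_def)
      qed
      moreover have "restrict (x_exponents m fs) {..N} = d"
      proof
        fix i show "restrict (x_exponents m fs) {..N} i = d i"
          using mem[of i] PiE_arb[OF d, of i] *
          by (cases "i = 0") (auto simp: factors_with_def x_exponents_def)
      qed
      ultimately show "(m, fs) \<in> ?S \<and> G (m, fs) = (e, d)"
        using len * d_le[of 0] by (auto simp: factor_lists_def G_def)
    qed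
    then have fiber: "{q \<in> ?S. G q = (e, d)} = {d 0} \<times> ?L"
      by auto
    have "(\<Sum>q \<in> {q \<in> ?S. G q = (e, d)}. ?h q)
        = (\<Sum>q \<in> {d 0} \<times> ?L. (deriv ^^ d 0) f u / fact (d 0) * ?W (snd q) * contraction_integral T t N d e)"
      unfolding fiber
    proof (intro sum.cong refl)
      fix q assume q: "q \<in> {d 0} \<times> ?L"
      have "contraction_integral T t N (x_exponents (d 0) (snd q)) (y_exponents (snd q))
          = contraction_integral T t N d e"
      proof (rule contraction_integral_cong)
        fix i assume "i \<le> N"
        then show "x_exponents (d 0) (snd q) i = d i"
          using q by (cases "i = 0") (auto simp: x_exponents_def factors_with_def)
      next
        fix j assume "j \<in> {1..N}"
        then show "y_exponents (snd q) j = e j"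
          using q by (auto simp: y_exponents_def factors_with_def)
      qed
      with q show "?h q = (deriv ^^ d 0) f u / fact (d 0) * ?W (snd q) * contraction_integral T t N d e"
        by (auto simp: factors_integral_def)
    qed
    also have "\<dots> = (deriv ^^ d 0) f u / fact (d 0) * (\<Sum>fs\<in>?L. ?W fs) * contraction_integral T t N d e"
      unfolding sum_distrib_left sum_distrib_right
      by (rule sum.reindex_bij_witness[of _ "\<lambda>fs. (d 0, fs)" snd]) auto
    also have "(\<Sum>fs\<in>?L. ?W fs) = (\<Prod>i = 1..N. \<Sum>\<phi>\<in>factors_with (e i) (d i). factor_weight \<alpha> \<beta> u \<phi>)"
      by (rule prod_sum_lists[symmetric]) (rule finite_factors_with)
    finally show "(\<Sum>q \<in> {q \<in> ?S. G q = (e, d)}. ?h q) = (deriv ^^ d 0) f u / fact (d 0) *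
       (\<Prod>i = 1..N. \<Sum>\<phi>\<in>factors_with (e i) (d i). factor_weight \<alpha> \<beta> u \<phi>) *
       contraction_integral T t N d e" .
  qed
  finally show ?thesis
    unfolding msr_expectation_eq_sum_patterns[OF assms] by simp
qed

section \<open>Summation over multi-indices\<close>

lemma card_enumerations:
  "real (card {fs'. mset fs' = mset fs}) = fact (length fs) / (\<Prod>\<phi>\<in>set fs. fact (count_list fs \<phi>))"
proof -
  have "card {fs'. mset fs' = mset fs} * (\<Prod>\<phi>\<in>set fs. fact (count_list fs \<phi>)) = (fact (length fs) :: nat)"
    using card_permutations_of_multiset_aux[of "mset fs"]
    by (simp add: permutations_of_multiset_def count_mset)
  from arg_cong[OF this, of real]
  have "real (card {fs'. mset fs' = mset fs}) * (\<Prod>\<phi>\<in>set fs. fact (count_list fs \<phi>)) = fact (length fs)"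
    by simp
  then show ?thesis
    by (simp add: eq_divide_eq)
qed

text \<open>A list of \<open>N\<close> factors offers at most \<open>2 N\<close> auxiliary fields, too few to contract a larger power of
  some field. Hence only finitely many multi-indices of a given order contribute.\<close>

lemma factors_integral_eq_0:
  assumes "m > 2 * length fs \<or> (\<exists>\<phi>\<in>set fs. x_exponent \<phi> > 2 * length fs)"
  shows "factors_integral T t m fs = 0"
proof -
  let ?N = "length fs"
  have "y_exponents fs j \<le> 2" for j
    unfolding y_exponents_def by (cases "fs ! (j - 1)") auto
  then have "(\<Sum>j = 1..?N. y_exponents fs j) \<le> (\<Sum>j = 1..?N. 2)"
    by (intro sum_mono)
  moreover obtain i where "i \<le> ?N" "x_exponents m fs i > 2 * ?N"
  proof (cases "m > 2 * ?N")
    case True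
    then show ?thesis using that[of 0] by (simp add: x_exponents_def)
  next
    case False
    with assms obtain k where "k < ?N" "x_exponent (fs ! k) > 2 * ?N"
      by (auto simp: in_set_conv_nth)
    then show ?thesis using that[of "Suc k"] by (simp add: x_exponents_def)
  qed
  ultimately have "contraction_number ?N s (x_exponents m fs) (y_exponents fs) = 0" for s
    by (intro contraction_number_eq_0[of i]) auto
  then show ?thesis
    by (simp add: factors_integral_def contraction_integral_def time_integral_def
        set_lebesgue_integral_def)
qed

theorem theorem3p8:
  fixes \<alpha> \<beta> f :: "real \<Rightarrow> real" and u0 T t :: real
  assumes "T > 0" and "real_analytic \<alpha>" and "real_analytic \<beta>" and "real_analytic f"
    and "t \<in> {0..T}"
  shows "\<forall>N. finite {\<gamma> \<in> feynman_multi_indices. mi_order \<gamma> = N \<and>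
                elementary_differential \<alpha> \<beta> f u0 \<gamma> / real (symmetry_factor \<gamma>)
                  * realization T t \<gamma> \<noteq> 0} \<and>
             ((\<lambda>\<gamma>. elementary_differential \<alpha> \<beta> f u0 \<gamma> / real (symmetry_factor \<gamma>)
                     * realization T t \<gamma>)
                has_sum msr_expectation \<alpha> \<beta> f u0 T t N)
               {\<gamma> \<in> feynman_multi_indices. mi_order \<gamma> = N}"
proof
  fix N
  let ?c = "\<lambda>\<gamma>. elementary_differential \<alpha> \<beta> f u0 \<gamma> / real (symmetry_factor \<gamma>) * realization T t \<gamma>"
  let ?M = "{\<gamma> \<in> feynman_multi_indices. mi_order \<gamma> = N}"
  let ?S = "{..2 * N} \<times> factor_lists (2 * N) N"
  let ?h = "\<lambda>(m, fs). (deriv ^^ m) f u0 / fact m * prod_list (map (factor_weight \<alpha> \<beta> u0) fs)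
    * factors_integral T t m fs"
  let ?\<mu> = "\<lambda>(m, fs). multi_index_of m fs"
  have fin: "finite (?\<mu> ` ?S)"
    by (simp add: finite_factor_lists)
  have sub: "?\<mu> ` ?S \<subseteq> ?M"
    by (auto simp: factor_lists_def factors_upto_def mi_order_multi_index_of
        intro!: multi_index_of_in_feynman_multi_indices)
  have zero: "?c \<gamma> = 0" if \<gamma>: "\<gamma> \<in> ?M - ?\<mu> ` ?S" for \<gamma>
  proof -
    obtain m fs where \<gamma>_eq: "\<gamma> = multi_index_of m fs" and ord: "\<And>\<phi>. \<phi> \<in> set fs \<Longrightarrow> ordered_factor \<phi>"
      using feynman_multi_indexE \<gamma> by blast
    then have len: "length fs = N"
      using \<gamma> by (simp add: mi_order_multi_index_of)
    have "(m, fs) \<notin> ?S"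
      using \<gamma> \<gamma>_eq by (metis (no_types, lifting) DiffD2 case_prod_conv image_eqI)
    then have "factors_integral T t m fs = 0"
      using ord len by (intro factors_integral_eq_0) (auto simp: factor_lists_def factors_upto_def not_le)
    then show ?thesis
      by (simp add: \<gamma>_eq realization_multi_index_of)
  qed
  have fiber_sum: "1 / fact N * (\<Sum>q | q \<in> ?S \<and> ?\<mu> q = \<gamma>. ?h q) = ?c \<gamma>" if "\<gamma> \<in> ?\<mu> ` ?S" for \<gamma>
  proof -
    from that obtain q where q: "\<gamma> = ?\<mu> q" "q \<in> ?S"
      by blast
    obtain m fs where "q = (m, fs)"
      by (rule prod.exhaust)
    with q have \<gamma>: "\<gamma> = multi_index_of m fs" and S: "m \<le> 2 * N" "fs \<in> factor_lists (2 * N) N"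
      by auto
    have len: "length fs = N"
      using S by (simp add: factor_lists_def)
    have "{q \<in> ?S. ?\<mu> q = \<gamma>} = {m} \<times> {fs'. mset fs' = mset fs}"
      using S mset_eq_setD mset_eq_length
      by (auto simp: \<gamma> multi_index_of_eq_iff factor_lists_def) blast+
    moreover have "?h (m, fs') = ?h (m, fs)" if "mset fs' = mset fs" for fs'
    proof -
      have "mset (map (factor_weight \<alpha> \<beta> u0) fs') = mset (map (factor_weight \<alpha> \<beta> u0) fs)"
        using that by simp
      then have "prod_list (map (factor_weight \<alpha> \<beta> u0) fs') = prod_list (map (factor_weight \<alpha> \<beta> u0) fs)"
        by (metis prod_mset_prod_list)
      then show ?thesis
        using factors_integral_cong_mset[OF that] by simp
    qed
    ultimately have "(\<Sum>q | q \<in> ?S \<and> ?\<mu> q = \<gamma>. ?h q)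
        = (\<Sum>q \<in> {m} \<times> {fs'. mset fs' = mset fs}. ?h (m, fs))"
      by (intro sum.cong) auto
    also have "\<dots> = real (card {fs'. mset fs' = mset fs}) * ?h (m, fs)"
      by (simp add: card_cartesian_product)
    finally show ?thesis
      by (simp add: \<gamma> len card_enumerations prod_list_map_eq_prod_count prod_dividef
          elementary_differential_over_symmetry_factor realization_multi_index_of)
  qed
  have "msr_expectation \<alpha> \<beta> f u0 T t N = 1 / fact N * sum ?h ?S"
    using assms by (intro msr_expectation_eq_sum_lists real_analytic_imp_smooth)
  also have "\<dots> = (\<Sum>\<gamma> \<in> ?\<mu> ` ?S. 1 / fact N * (\<Sum>q | q \<in> ?S \<and> ?\<mu> q = \<gamma>. ?h q))"
    by (subst sum.image_gen[of ?S _ ?\<mu>]) (auto simp: finite_factor_lists sum_distrib_left)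
  also have "\<dots> = sum ?c (?\<mu> ` ?S)"
    by (intro sum.cong refl fiber_sum)
  finally have "msr_expectation \<alpha> \<beta> f u0 T t N = sum ?c (?\<mu> ` ?S)" .
  then have "(?c has_sum msr_expectation \<alpha> \<beta> f u0 T t N) ?M"
    using fin sub zero by (intro has_sum_finite_neutralI[of "?\<mu> ` ?S"])
  moreover have "finite {\<gamma> \<in> feynman_multi_indices. mi_order \<gamma> = N \<and> ?c \<gamma> \<noteq> 0}"
    by (rule finite_subset[OF _ fin]) (use zero in blast)
  ultimately show "finite {\<gamma> \<in> feynman_multi_indices. mi_order \<gamma> = N \<and> ?c \<gamma> \<noteq> 0} \<and>
      (?c has_sum msr_expectation \<alpha> \<beta> f u0 T t N) ?M"
    by blast
qed

end
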